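(* Consider data $X=(X_1,\dots,X_n)$ sampled independently from a density $g_0$ on $[0,1]$ that is bounded away from $0$, and suppose $f_0:=\log g_0\in\mathcal H^\beta(L)$ for some $\beta,L>0$. Let $h$ be a probability density on $\mathbb R$ such that: (i) $h$ is symmetric, positive, bounded, and decreasing on $[0,\infty)$; (ii) for some $c_1>0$, $\kappa\ge0$, $\log(1/h(x))\le c_1(1+\log^{1+\kappa}(1+x))$ for all $x\ge0$; (iii) for some $c_2>0$, $\int_x^\infty h(u)\,du\le c_2/x^2$ for all $x\ge1$. Let $f=\sum_{l\ge0}\sum_{k\in\mathcal K_l}f_{lk}\psi_{lk}$ be random with $f_{lk}=s_l\zeta_{lk}$, $(\zeta_{lk})$ i.i.d. of density $h$, and let $\Pi$ be the induced prior on densities $$g(x)=g_f(x)=\frac{e^{f(x)}}{\int_0^1e^{f(u)}\,du},\qquad x\in[0,1].$$ Assume one of the following two settings: (1) $s_l=2^{-l(1/2+\alpha)}$ with $\alpha>1/2$ and $\beta\le\alpha$, and $\varepsilon_n=(\log\log n)^{\frac{2}{1+2\beta}}(\log n)^{\frac{1+(1+\kappa)\beta}{1+2\beta}}n^{-\frac{\beta}{2\beta+1}}$; (2) $s_l=2^{-l^2}$, and $\varepsilon_n=(\log n)^{\frac{(2+2\kappa)\beta}{1+2\beta}}n^{-\frac{\beta}{2\beta+1}}$. Then for any $\rho\in(0,1)$ there exists $M=M(\rho)>0$ such that, as $n\to\infty$, $$E_{g_0}\Pi_\rho[\|g-g_0\|_1>M\varepsilon_n\mid X]\to0.$$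
   Context: $\{\psi_{lk}:l\ge0,k\in\mathcal K_l\}$, $\mathcal K_l=\{0,\dots,2^l-1\}$, is an orthonormal boundary-corrected wavelet basis of $L^2[0,1]$ (the scaling function being denoted as the first wavelet $\psi_{00}$); such a basis satisfies $\sup_{x\in[0,1]}\sum_{k\in\mathcal K_l}|\psi_{lk}(x)|\le C2^{l/2}$ for all $l$ and a constant $C$. Write $f_{lk}=\langle f,\psi_{lk}\rangle$. The Hölder-type ball is $\mathcal H^\beta(L)=\{f=(f_{lk}):\ \max_{k\in\mathcal K_l}|f_{lk}|\le2^{-l(1/2+\beta)}L\ \text{for all } l\ge0\}$. $\|\cdot\|_1$ is the $L^1[0,1]$ norm. The $\rho$-posterior (tempered posterior) is $$\Pi_\rho[B\mid X]=\frac{\int_B\big(\prod_{i=1}^ng(X_i)\big)^\rho\,d\Pi(g)}{\int\big(\prod_{i=1}^ng(X_i)\big)^\rho\,d\Pi(g)}$$ for measurable $B$. $E_{g_0}$ is the expectation when $X_1,\dots,X_n$ are i.i.d. of density $g_0$. *)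

theory Defs
  imports "HOL-Probability.Probability"
begin

abbreviation unit_measure :: "real measure" where
  "unit_measure \<equiv> restrict_space lborel {0..1}"

(* Extended-nonnegative valued, so that a function which is not integrable has norm infinity. *)
definition L1_norm :: "(real \<Rightarrow> real) \<Rightarrow> ennreal" where
  "L1_norm u = (\<integral>\<^sup>+ x. ennreal \<bar>u x\<bar> \<partial>unit_measure)"

definition square_integrable :: "(real \<Rightarrow> real) \<Rightarrow> bool" where
  "square_integrable f \<longleftrightarrow>
     f \<in> borel_measurable unit_measure \<and> integrable unit_measure (\<lambda>x. (f x)\<^sup>2)"

definition inner_L2 :: "(real \<Rightarrow> real) \<Rightarrow> (real \<Rightarrow> real) \<Rightarrow> real" where
  "inner_L2 f g = (\<integral>x. f x * g x \<partial>unit_measure)"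

(* The index set at level l: {0, ..., 2^l - 1}. *)
definition K :: "nat \<Rightarrow> nat set" where
  "K l = {..<2 ^ l}"

definition orthonormal_basis_L2 :: "(nat \<Rightarrow> nat \<Rightarrow> real \<Rightarrow> real) \<Rightarrow> bool" where
  "orthonormal_basis_L2 \<psi> \<longleftrightarrow>
     (\<forall>l. \<forall>k\<in>K l. square_integrable (\<psi> l k)) \<and>
     (\<forall>l. \<forall>k\<in>K l. \<forall>l'. \<forall>k'\<in>K l'.
        inner_L2 (\<psi> l k) (\<psi> l' k') = (if l = l' \<and> k = k' then 1 else 0)) \<and>
     (\<forall>f. square_integrable f \<longrightarrow>
        (\<lambda>N. \<integral>x. (f x - (\<Sum>l<N. \<Sum>k\<in>K l. inner_L2 f (\<psi> l k) * \<psi> l k x))\<^sup>2 \<partial>unit_measure)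
          \<longlonglongrightarrow> 0)"

(* The defining properties of a boundary-corrected wavelet basis of L^2[0,1] kept here: an orthonormal
   basis indexed by levels l with 2^l functions each, and the localisation bound.  No particular
   construction (multiresolution analysis, boundary functions) is fixed; \<psi> 0 0 is the scaling
   function. *)
definition wavelet_basis :: "(nat \<Rightarrow> nat \<Rightarrow> real \<Rightarrow> real) \<Rightarrow> bool" where
  "wavelet_basis \<psi> \<longleftrightarrow> orthonormal_basis_L2 \<psi> \<and>
     (\<exists>C. \<forall>l. \<forall>x\<in>{0..1}. (\<Sum>k\<in>K l. \<bar>\<psi> l k x\<bar>) \<le> C * 2 powr (real l / 2))"

definition holder_ball :: "(nat \<Rightarrow> nat \<Rightarrow> real \<Rightarrow> real) \<Rightarrow> real \<Rightarrow> real \<Rightarrow> (real \<Rightarrow> real) set" where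
  "holder_ball \<psi> \<beta> L = {f. square_integrable f \<and>
     (\<forall>l. (MAX k\<in>K l. \<bar>inner_L2 f (\<psi> l k)\<bar>) \<le> 2 powr (- (real l * (1/2 + \<beta>))) * L)}"

definition density_on_unit :: "(real \<Rightarrow> real) \<Rightarrow> bool" where
  "density_on_unit g \<longleftrightarrow> g \<in> borel_measurable unit_measure \<and> (\<forall>x\<in>{0..1}. 0 \<le> g x) \<and>
     (\<integral>\<^sup>+ x. ennreal (g x) \<partial>unit_measure) = 1"

definition density_on_real :: "(real \<Rightarrow> real) \<Rightarrow> bool" where
  "density_on_real h \<longleftrightarrow> h \<in> borel_measurable borel \<and> (\<forall>x. 0 \<le> h x) \<and>
     (\<integral>\<^sup>+ x. ennreal (h x) \<partial>lborel) = 1"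

(* The values outside [0,1] of a function play no role. *)
definition exp_density :: "(real \<Rightarrow> real) \<Rightarrow> real \<Rightarrow> real" where
  "exp_density f x = exp (f x) / (\<integral>u. exp (f u) \<partial>unit_measure)"

definition wavelet_series ::
    "(nat \<Rightarrow> nat \<Rightarrow> real \<Rightarrow> real) \<Rightarrow> (nat \<Rightarrow> nat \<Rightarrow> real) \<Rightarrow> real \<Rightarrow> real" where
  "wavelet_series \<psi> a x = (\<Sum>l. \<Sum>k\<in>K l. a l k * \<psi> l k x)"

(* The sigma-algebra carrying the prior: the coarsest one for which the point evaluations at
   x in [0,1] (hence the likelihood) and the L^1 distances to fixed functions are measurable. *)
definition function_space :: "(real \<Rightarrow> real) measure" where
  "function_space = sigma UNIV
     ({{g. g x \<in> A} | x A. x \<in> {0..1} \<and> A \<in> sets (borel :: real measure)} \<union>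
      {{g. L1_norm (\<lambda>x. g x - d x) \<in> A} | d A.
         d \<in> borel_measurable unit_measure \<and> A \<in> sets (borel :: ennreal measure)})"

definition density_prior :: "'w measure \<Rightarrow> (nat \<Rightarrow> nat \<Rightarrow> real \<Rightarrow> real) \<Rightarrow> (nat \<Rightarrow> real) \<Rightarrow>
    (nat \<Rightarrow> nat \<Rightarrow> 'w \<Rightarrow> real) \<Rightarrow> (real \<Rightarrow> real) measure" where
  "density_prior P \<psi> s \<zeta> =
     distr P function_space (\<lambda>\<omega>. exp_density (wavelet_series \<psi> (\<lambda>l k. s l * \<zeta> l k \<omega>)))"

definition rho_posterior ::
    "real \<Rightarrow> (real \<Rightarrow> real) measure \<Rightarrow> nat \<Rightarrow> (nat \<Rightarrow> real) \<Rightarrow> (real \<Rightarrow> real) set \<Rightarrow> ennreal" where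
  "rho_posterior \<rho> Q n X B =
     (\<integral>\<^sup>+g\<in>B. ennreal ((\<Prod>i<n. g (X i)) powr \<rho>) \<partial>Q) /
     (\<integral>\<^sup>+ g. ennreal ((\<Prod>i<n. g (X i)) powr \<rho>) \<partial>Q)"

definition sample_law :: "(real \<Rightarrow> real) \<Rightarrow> nat \<Rightarrow> (nat \<Rightarrow> real) measure" where
  "sample_law g0 n = PiM {..<n} (\<lambda>_. density unit_measure (\<lambda>x. ennreal (g0 x)))"


text \<open>The prior is a genuine image measure, and the events and integrals in the definition of the
  posterior are measurable.\<close>

lemma space_function_space [simp]: "space function_space = UNIV"
  by (simp add: function_space_def space_measure_of_conv)

lemma measurable_eval_function_space:
  assumes "x \<in> {0..1}"
  shows "(\<lambda>g. g x) \<in> borel_measurable function_space"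
proof (rule measurableI)
  fix A :: "real set" assume "A \<in> sets borel"
  then have "{g. g x \<in> A} \<in> sets function_space"
    unfolding function_space_def using assms
    by (subst sets_measure_of) (auto intro!: sigma_sets.Basic)
  then show "(\<lambda>g. g x) -` A \<inter> space function_space \<in> sets function_space"
    by (simp add: vimage_def)
qed simp

lemma measurable_L1_dist_function_space:
  assumes "d \<in> borel_measurable unit_measure"
  shows "(\<lambda>g. L1_norm (\<lambda>x. g x - d x)) \<in> borel_measurable function_space"
proof (rule measurableI)
  fix A :: "ennreal set" assume "A \<in> sets borel"
  then have "{g. L1_norm (\<lambda>x. g x - d x) \<in> A} \<in> sets function_space"
    unfolding function_space_def using assms
    by (subst sets_measure_of) (auto intro!: sigma_sets.Basic)
  then show "(\<lambda>g. L1_norm (\<lambda>x. g x - d x)) -` A \<inter> space function_space \<in> sets function_space"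
    by (simp add: vimage_def)
qed simp

lemma sets_L1_dist_greater:
  assumes "d \<in> borel_measurable unit_measure"
  shows "{g. L1_norm (\<lambda>x. g x - d x) > r} \<in> sets function_space"
proof -
  note [measurable] = measurable_L1_dist_function_space[OF assms]
  have "{g \<in> space function_space. L1_norm (\<lambda>x. g x - d x) > r} \<in> sets function_space"
    by measurable
  then show ?thesis by simp
qed

lemma sigma_finite_unit_measure: "sigma_finite_measure unit_measure"
  by (rule sigma_finite_measure_restrict_space) (auto intro: lborel.sigma_finite_measure_axioms)

lemma measurable_exp_density_pair:
  assumes \<psi>: "\<And>l k. k \<in> K l \<Longrightarrow> \<psi> l k \<in> borel_measurable unit_measure"
    and \<zeta>: "\<And>l k. k \<in> K l \<Longrightarrow> \<zeta> l k \<in> borel_measurable P"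
  shows "(\<lambda>(\<omega>, x). exp_density (wavelet_series \<psi> (\<lambda>l k. s l * \<zeta> l k \<omega>)) x)
           \<in> borel_measurable (P \<Otimes>\<^sub>M unit_measure)"
proof -
  interpret U: sigma_finite_measure unit_measure by (rule sigma_finite_unit_measure)
  have F: "(\<lambda>z. wavelet_series \<psi> (\<lambda>l k. s l * \<zeta> l k (fst z)) (snd z))
      \<in> borel_measurable (P \<Otimes>\<^sub>M unit_measure)"
    unfolding wavelet_series_def
    by (intro borel_measurable_suminf borel_measurable_sum borel_measurable_times
          borel_measurable_const measurable_compose[OF measurable_fst \<zeta>]
          measurable_compose[OF measurable_snd \<psi>])
  have "(\<lambda>\<omega>. \<integral>u. exp (wavelet_series \<psi> (\<lambda>l k. s l * \<zeta> l k \<omega>) u) \<partial>unit_measure)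
      \<in> borel_measurable P"
    using F by (intro U.borel_measurable_lebesgue_integral) (simp add: case_prod_beta')
  from measurable_compose[OF measurable_fst this] F show ?thesis
    unfolding exp_density_def case_prod_beta'
    by (intro borel_measurable_divide borel_measurable_exp) auto
qed

lemma measurable_exp_density_function_space:
  assumes \<psi>: "\<And>l k. k \<in> K l \<Longrightarrow> \<psi> l k \<in> borel_measurable unit_measure"
    and \<zeta>: "\<And>l k. k \<in> K l \<Longrightarrow> \<zeta> l k \<in> borel_measurable P"
  shows "(\<lambda>\<omega>. exp_density (wavelet_series \<psi> (\<lambda>l k. s l * \<zeta> l k \<omega>)))
           \<in> measurable P function_space" (is "?G \<in> _")
proof -
  interpret U: sigma_finite_measure unit_measure by (rule sigma_finite_unit_measure)
  note pair = measurable_exp_density_pair[of \<psi> \<zeta> P s, OF \<psi> \<zeta>]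
  have eval: "(\<lambda>\<omega>. ?G \<omega> x) \<in> borel_measurable P" if "x \<in> {0..1}" for x
    using measurable_compose[OF measurable_Pair2'[of x unit_measure P] pair] that
    by (simp add: space_restrict_space)
  have dist: "(\<lambda>\<omega>. L1_norm (\<lambda>x. ?G \<omega> x - d x)) \<in> borel_measurable P"
    if "d \<in> borel_measurable unit_measure" for d
  proof -
    have "(\<lambda>z. ennreal \<bar>?G (fst z) (snd z) - d (snd z)\<bar>)
        \<in> borel_measurable (P \<Otimes>\<^sub>M unit_measure)"
      using pair measurable_compose[OF measurable_snd that, of P]
      by (intro measurable_compose[OF _ measurable_ennreal] borel_measurable_abs
            borel_measurable_diff) (simp_all add: case_prod_beta')
    then show ?thesis
      unfolding L1_norm_def
      by (intro U.borel_measurable_nn_integral) (simp add: case_prod_beta')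
  qed
  show ?thesis
    unfolding function_space_def
  proof (rule measurable_measure_of)
    fix Y assume "Y \<in> {{g. g x \<in> A} | x A. x \<in> {0..1} \<and> A \<in> sets (borel :: real measure)} \<union>
      {{g. L1_norm (\<lambda>x. g x - d x) \<in> A} | d A.
         d \<in> borel_measurable unit_measure \<and> A \<in> sets (borel :: ennreal measure)}"
    then consider x A where "x \<in> {0..1}" "A \<in> sets borel" "Y = {g. g x \<in> A}"
      | d A where "d \<in> borel_measurable unit_measure" "A \<in> sets borel"
          "Y = {g. L1_norm (\<lambda>x. g x - d x) \<in> A}"
      by blast
    then show "?G -` Y \<inter> space P \<in> sets P"
    proof cases
      case 1
      then show ?thesis using measurable_sets[OF eval[OF 1(1)] 1(2)] by (simp add: vimage_def)
    next
      case 2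
      then show ?thesis using measurable_sets[OF dist[OF 2(1)] 2(2)] by (simp add: vimage_def)
    qed
  qed auto
qed

lemma prob_space_density_prior:
  assumes "prob_space P"
    and "\<And>l k. k \<in> K l \<Longrightarrow> \<psi> l k \<in> borel_measurable unit_measure"
    and "\<And>l k. k \<in> K l \<Longrightarrow> \<zeta> l k \<in> borel_measurable P"
  shows "prob_space (density_prior P \<psi> s \<zeta>)"
  unfolding density_prior_def
  by (intro prob_space.prob_space_distr assms measurable_exp_density_function_space)

lemma measurable_rho_posterior:
  assumes P: "prob_space P"
    and \<psi>: "\<And>l k. k \<in> K l \<Longrightarrow> \<psi> l k \<in> borel_measurable unit_measure"
    and \<zeta>: "\<And>l k. k \<in> K l \<Longrightarrow> \<zeta> l k \<in> borel_measurable P"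
    and B: "B \<in> sets function_space"
  shows "(\<lambda>X. rho_posterior \<rho> (density_prior P \<psi> s \<zeta>) n X B)
           \<in> borel_measurable (sample_law g0 n)"
proof -
  interpret P: prob_space P by (rule P)
  define G where "G \<omega> = exp_density (wavelet_series \<psi> (\<lambda>l k. s l * \<zeta> l k \<omega>))" for \<omega>
  have G: "G \<in> measurable P function_space"
    unfolding G_def by (intro measurable_exp_density_function_space \<psi> \<zeta>)
  have pair: "(\<lambda>(\<omega>, x). G \<omega> x) \<in> borel_measurable (P \<Otimes>\<^sub>M unit_measure)"
    unfolding G_def by (rule measurable_exp_density_pair[OF \<psi> \<zeta>])
  let ?S = "PiM {..<n} (\<lambda>_. unit_measure)"
  have S: "sets (sample_law g0 n) = sets ?S"
    unfolding sample_law_def by (intro sets_PiM_cong) auto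
  have joint: "(\<lambda>z. ennreal ((\<Prod>i<n. G (snd z) (fst z i)) powr \<rho>))
      \<in> borel_measurable (?S \<Otimes>\<^sub>M P)"
  proof -
    have "(\<lambda>z. G (snd z) (fst z i)) \<in> borel_measurable (?S \<Otimes>\<^sub>M P)" if "i < n" for i
    proof -
      have "(\<lambda>z. (snd z, fst z i)) \<in> (?S \<Otimes>\<^sub>M P) \<rightarrow>\<^sub>M (P \<Otimes>\<^sub>M unit_measure)"
        using that by (intro measurable_Pair measurable_snd
          measurable_compose[OF measurable_fst measurable_component_singleton]) auto
      from measurable_compose[OF this pair] show ?thesis by simp
    qed
    then show ?thesis by measurable
  qed
  have GB: "(\<lambda>z. indicator B (G (snd z)) :: ennreal) \<in> borel_measurable (?S \<Otimes>\<^sub>M P)"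
    by (intro measurable_compose[OF measurable_compose[OF measurable_snd G]]
          borel_measurable_indicator B)
  have L: "(\<lambda>g. ennreal ((\<Prod>i<n. g (X i)) powr \<rho>)) \<in> borel_measurable function_space"
    if "X \<in> space ?S" for X
  proof -
    have "(\<lambda>g. g (X i)) \<in> borel_measurable function_space" if "i < n" for i
      using \<open>X \<in> space ?S\<close> that
      by (intro measurable_eval_function_space) (auto simp: space_PiM space_restrict_space PiE_def Pi_def)
    then show ?thesis by measurable
  qed
  have eq: "rho_posterior \<rho> (density_prior P \<psi> s \<zeta>) n X B =
      (\<integral>\<^sup>+ \<omega>. ennreal ((\<Prod>i<n. G \<omega> (X i)) powr \<rho>) * indicator B (G \<omega>) \<partial>P) /
      (\<integral>\<^sup>+ \<omega>. ennreal ((\<Prod>i<n. G \<omega> (X i)) powr \<rho>) \<partial>P)" if "X \<in> space ?S" for X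
    unfolding rho_posterior_def density_prior_def G_def[symmetric]
    using L[OF that] B G by (subst (1 2) nn_integral_distr) (auto simp: sets_eq_imp_space_eq)
  have "(\<lambda>X. (\<integral>\<^sup>+ \<omega>. ennreal ((\<Prod>i<n. G \<omega> (X i)) powr \<rho>) * indicator B (G \<omega>) \<partial>P) /
      (\<integral>\<^sup>+ \<omega>. ennreal ((\<Prod>i<n. G \<omega> (X i)) powr \<rho>) \<partial>P)) \<in> borel_measurable ?S"
    using joint GB
    by (intro borel_measurable_divide_ennreal P.borel_measurable_nn_integral)
       (simp_all add: case_prod_beta')
  then have "(\<lambda>X. rho_posterior \<rho> (density_prior P \<psi> s \<zeta>) n X B) \<in> borel_measurable ?S"
    by (subst measurable_cong[OF eq])
  then show ?thesis
    by (simp add: measurable_cong_sets[OF S refl])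
qed

end

theory Submission
  imports Defs "HOL-Real_Asymp.Real_Asymp"
begin

text \<open>For a tempered posterior only prior mass is needed. Up to a normalisation that cancels, the
  numerator over the densities at \<open>L\<^sup>1\<close> distance more than \<open>r\<close> from \<open>g0\<close> has mean at most
  \<open>exp (- \<gamma> n r\<^sup>2)\<close>, because the tempered affinity is at most \<open>1 - \<gamma> r\<^sup>2\<close>. On a prior event of log-densities
  uniformly close to \<open>ln g0\<close>, with distance of order \<open>u\<close>, the reciprocal of the denominator has mean at
  most \<open>exp (2 n u\<^sup>2)\<close> divided by the probability of the event; no high-probability bound on the
  denominator is required, since a product \<open>x * y\<close> that is at most \<open>1\<close> is at most \<open>a * x + y / a\<close>.
  The prior mass of a ball of radius of order \<open>2 powr (- J * \<beta>)\<close> is bounded below by pinning the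
  coefficients of levels up to \<open>J\<close> and letting those of level \<open>l > J\<close> grow like
  \<open>2 powr ((l - J) * (1/4 + \<alpha>/2))\<close>; by the quadratic tail bound the latter costs only a factor
  \<open>exp (- c * 2 ^ J)\<close>. The resulting rate is \<open>(n / (ln n) powr w) powr (- \<beta> / (2 * \<beta> + 1))\<close>, where
  \<open>w\<close> is \<open>1 + \<kappa>\<close> in the first setting and \<open>2 * (1 + \<kappa>)\<close> in the second.\<close>

section \<open>Affinities of densities\<close>

lemma weighted_AM_GM:
  fixes a b t :: real
  assumes "0 \<le> a" "0 \<le> b" "0 < t" "t < 1"
  shows "a powr t * b powr (1 - t) \<le> t * a + (1 - t) * b"
  using Youngs_inequality_0[of t "1 - t" a b] assms by (cases "a = 0 \<or> b = 0") auto

text \<open>Split off the factor \<open>sqrt (a * b)\<close> to the power \<open>2 * min \<rho> (1 - \<rho>)\<close>, so that weighted AM-GM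
  leaves a multiple of the squared Hellinger difference.\<close>
lemma powr_mult_le_sub_hellinger:
  fixes a b \<rho> :: real
  assumes "0 \<le> a" "0 \<le> b" "0 < \<rho>" "\<rho> < 1"
  shows "a powr \<rho> * b powr (1 - \<rho>)
    \<le> \<rho> * a + (1 - \<rho>) * b - min \<rho> (1 - \<rho>) * (sqrt a - sqrt b)\<^sup>2"
proof -
  \<comment> \<open>Exchanging \<open>a\<close> with \<open>b\<close> and \<rho> with 1 - \<rho>
    leaves the claim unchanged, so \<rho> at most 1/2 suffices and the minimum is \<rho>. The value
    1/2 is separate because weighted AM-GM with exponent 2 * \<rho> needs it below 1; there the
    bound is an equality.\<close>
  have half: "a powr \<rho> * b powr (1 - \<rho>) \<le> \<rho> * a + (1 - \<rho>) * b - \<rho> * (sqrt a - sqrt b)\<^sup>2"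
    if ab: "0 \<le> a" "0 \<le> b" and \<rho>: "0 < \<rho>" "\<rho> \<le> 1/2" for a b \<rho> :: real
  proof -
    have sq: "(sqrt a - sqrt b)\<^sup>2 = a + b - 2 * sqrt (a * b)"
      using ab by (simp add: power2_diff real_sqrt_mult)
    have "a powr \<rho> * b powr (1 - \<rho>) \<le> 2 * \<rho> * sqrt (a * b) + (1 - 2 * \<rho>) * b"
    proof (cases "\<rho> = 1/2")
      case True
      show ?thesis
        unfolding True using ab by (simp add: powr_half_sqrt real_sqrt_mult)
    next
      case False
      have "sqrt (a * b) powr (2 * \<rho>) * b powr (1 - 2 * \<rho>) = a powr \<rho> * (b powr \<rho> * b powr (1 - 2 * \<rho>))"
        using ab by (simp flip: powr_half_sqrt add: powr_powr powr_mult)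
      also have "b powr \<rho> * b powr (1 - 2 * \<rho>) = b powr (1 - \<rho>)"
        by (simp flip: powr_add)
      finally show ?thesis
        using weighted_AM_GM[of "sqrt (a * b)" b "2 * \<rho>"] ab \<rho> False by simp
    qed
    then show ?thesis unfolding sq by (simp add: algebra_simps)
  qed
  show ?thesis
  proof (cases "\<rho> \<le> 1/2")
    case True
    then show ?thesis using half[of a b \<rho>] assms by (simp add: min_def)
  next
    case False
    then show ?thesis using half[of b a "1 - \<rho>"] assms
      by (simp add: min_def mult.commute power2_commute)
  qed
qed

text \<open>Factor a - b as (sqrt a - sqrt b) * (sqrt a + sqrt b) and apply AM-GM with weight r / 4.
  This is Cauchy-Schwarz made pointwise: with the free parameter \<open>r\<close>, the bound is
  linear in quantities whose integrals are known.\<close>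

lemma hellinger_ge_abs_diff:
  fixes a b r :: real
  assumes "0 \<le> a" "0 \<le> b" "0 < r"
  shows "r / 2 * \<bar>a - b\<bar> - r\<^sup>2 / 8 * (a + b) \<le> (sqrt a - sqrt b)\<^sup>2"
proof -
  define x y where "x = \<bar>sqrt a - sqrt b\<bar>" and "y = sqrt a + sqrt b"
  have "\<bar>a - b\<bar> = x * y"
  proof -
    have "a - b = (sqrt a - sqrt b) * (sqrt a + sqrt b)"
      using assms by (simp add: algebra_simps)
    then show ?thesis using assms by (simp add: x_def y_def abs_mult)
  qed
  moreover have "y\<^sup>2 \<le> 2 * (a + b)"
  proof -
    have "2 * (a + b) - y\<^sup>2 = (sqrt a - sqrt b)\<^sup>2"
      using assms by (simp add: y_def power2_sum power2_diff)
    then show ?thesis by (metis diff_ge_0_iff_ge zero_le_power2)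
  qed
  then have "r\<^sup>2 / 16 * y\<^sup>2 \<le> r\<^sup>2 / 16 * (2 * (a + b))"
    by (intro mult_left_mono) auto
  moreover have "r / 2 * (x * y) \<le> x\<^sup>2 + r\<^sup>2 / 16 * y\<^sup>2"
    using zero_le_power2[of "x - r / 4 * y"] by (simp add: power2_eq_square algebra_simps)
  moreover have "x\<^sup>2 = (sqrt a - sqrt b)\<^sup>2" by (simp add: x_def)
  ultimately show ?thesis by (simp add: field_simps)
qed

lemma AE_unit_measureI:
  assumes "\<And>x. 0 \<le> x \<Longrightarrow> x \<le> 1 \<Longrightarrow> Q x"
  shows "AE x in unit_measure. Q x"
  using assms by (auto intro!: AE_I2 simp: space_restrict_space)

lemma density_on_unit_integrable:
  assumes "density_on_unit g"
  shows "integrable unit_measure g" "(\<integral>x. g x \<partial>unit_measure) = 1"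
proof -
  have "has_bochner_integral unit_measure g 1"
    using assms unfolding density_on_unit_def
    by (intro has_bochner_integral_nn_integral) (auto intro: AE_unit_measureI)
  then show "integrable unit_measure g" "(\<integral>x. g x \<partial>unit_measure) = 1"
    by (auto simp: has_bochner_integral_iff)
qed

text \<open>Integrating the pointwise bounds, both densities having mass one, gives 1 - \<gamma> *
  (r / 2 * N - r^2 / 4) with N the distance. Since N > r, the bracket is at least r^2 / 4, and 1 - z
  \<le> exp (- z) finishes.\<close>

lemma tempered_affinity_le:
  assumes g: "density_on_unit g" and g0: "density_on_unit g0"
    and \<rho>: "0 < \<rho>" "\<rho> < 1" and r: "0 < r"
    and far: "L1_norm (\<lambda>x. g x - g0 x) > ennreal r"
  shows "(\<integral>\<^sup>+x. ennreal (g x powr \<rho> * g0 x powr (1 - \<rho>)) \<partial>unit_measure)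
    \<le> ennreal (exp (- (min \<rho> (1 - \<rho>) * r\<^sup>2 / 4)))"
proof -
  let ?\<gamma> = "min \<rho> (1 - \<rho>)"
  note [measurable] = g[unfolded density_on_unit_def, THEN conjunct1] g0[unfolded density_on_unit_def, THEN conjunct1]
  note I [simp] = density_on_unit_integrable[OF g] density_on_unit_integrable[OF g0]
  have pos: "0 \<le> g x" "0 \<le> g0 x" if "0 \<le> x" "x \<le> 1" for x
    using g g0 that by (auto simp: density_on_unit_def)
  let ?N = "\<integral>x. \<bar>g x - g0 x\<bar> \<partial>unit_measure"
  let ?d = "\<lambda>x. \<rho> * g x + (1 - \<rho>) * g0 x - ?\<gamma> * (r / 2 * \<bar>g x - g0 x\<bar> - r\<^sup>2 / 8 * (g x + g0 x))"
  have N: "r < ?N"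
    using far r unfolding L1_norm_def
    by (subst (asm) nn_integral_eq_integral) (auto simp: ennreal_less_iff)
  have le: "g x powr \<rho> * g0 x powr (1 - \<rho>) \<le> ?d x" if "0 \<le> x" "x \<le> 1" for x
  proof -
    have "?\<gamma> * (r / 2 * \<bar>g x - g0 x\<bar> - r\<^sup>2 / 8 * (g x + g0 x)) \<le> ?\<gamma> * (sqrt (g x) - sqrt (g0 x))\<^sup>2"
      using \<rho> by (intro mult_left_mono hellinger_ge_abs_diff pos that r) auto
    then show ?thesis
      using powr_mult_le_sub_hellinger[OF pos[OF that] \<rho>] by linarith
  qed
  \<comment> \<open>The sign of this expression is not visible, but it dominates a product of
    powers. Nonnegativity allows the passage from the extended integral to the Bochner
    integral.\<close>
  then have d0: "0 \<le> ?d x" if "0 \<le> x" "x \<le> 1" for x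
    using that by (meson mult_nonneg_nonneg order_trans powr_ge_zero)
  have int: "integrable unit_measure ?d"
    by (intro Bochner_Integration.integrable_diff Bochner_Integration.integrable_add
        integrable_mult_right integrable_abs I)
  have "(\<integral>\<^sup>+x. ennreal (g x powr \<rho> * g0 x powr (1 - \<rho>)) \<partial>unit_measure)
      \<le> (\<integral>\<^sup>+x. ennreal (?d x) \<partial>unit_measure)"
    using le by (intro nn_integral_mono ennreal_leI) (auto simp: space_restrict_space)
  also have "\<dots> = ennreal (\<integral>x. ?d x \<partial>unit_measure)"
    using d0 by (intro nn_integral_eq_integral int AE_unit_measureI)
  also have "(\<integral>x. ?d x \<partial>unit_measure) = 1 - ?\<gamma> * (r / 2 * ?N - r\<^sup>2 / 4)"
    using I by (simp add: integrable_abs)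
  also have "1 - ?\<gamma> * (r / 2 * ?N - r\<^sup>2 / 4) \<le> 1 + - (?\<gamma> * r\<^sup>2 / 4)"
  proof -
    have "r / 2 * r \<le> r / 2 * ?N" using N r by (intro mult_left_mono) auto
    then have "?\<gamma> * (r\<^sup>2 / 4) \<le> ?\<gamma> * (r / 2 * ?N - r\<^sup>2 / 4)"
      using \<rho> by (intro mult_left_mono) (auto simp: power2_eq_square)
    then show ?thesis by simp
  qed
  also have "\<dots> \<le> exp (- (?\<gamma> * r\<^sup>2 / 4))"
    by (rule exp_ge_add_one_self)
  finally show ?thesis by (simp add: ennreal_leI)
qed

section \<open>Inverse affinity of nearby densities\<close>

text \<open>For negative z, combine (1 + z + z^2) * (1 - z) = 1 - z^3 \<ge> 1 with 1 - z \<le> exp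
  (- z).\<close>

lemma exp_le_quadratic:
  fixes z :: real
  assumes "\<bar>z\<bar> \<le> 1"
  shows "exp z \<le> 1 + z + z\<^sup>2"
proof (cases "0 \<le> z")
  case True
  then show ?thesis using exp_bound[of z] assms by simp
next
  case False
  then have "0 < z\<^sup>2 - z\<^sup>2 * z" by (simp add: mult_pos_neg)
  moreover have "1 - z \<le> exp (- z)" using exp_ge_add_one_self[of "- z"] by simp
  ultimately have "(1 + z + z\<^sup>2) * (1 - z) \<le> (1 + z + z\<^sup>2) * exp (- z)"
    using assms False by (intro mult_left_mono) auto
  moreover have "0 \<le> (- z) ^ 3" using False by (intro zero_le_power) simp
  then have "1 \<le> (1 + z + z\<^sup>2) * (1 - z)"
    by (simp add: algebra_simps power2_eq_square power3_eq_cube)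
  ultimately have "1 * exp z \<le> (1 + z + z\<^sup>2) * exp (- z) * exp z"
    by (intro mult_right_mono) auto
  then show ?thesis by (simp add: mult.assoc flip: exp_add)
qed

text \<open>Since \<open>g / g0\<close> has mean one under \<open>g0\<close>, the mean of \<open>ln (g0 / g)\<close> is of second order.\<close>
lemma inverse_tempered_affinity_le:
  assumes g: "density_on_unit g" and g0: "density_on_unit g0"
    and pos: "\<And>x. 0 \<le> x \<Longrightarrow> x \<le> 1 \<Longrightarrow> 0 < g x" "\<And>x. 0 \<le> x \<Longrightarrow> x \<le> 1 \<Longrightarrow> 0 < g0 x"
    and \<rho>: "0 < \<rho>" "\<rho> < 1" and u: "0 \<le> u" "u \<le> 1"
    and near: "AE x in unit_measure. \<bar>ln (g x) - ln (g0 x)\<bar> \<le> u"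
  shows "(\<integral>\<^sup>+x. ennreal (g0 x powr (1 + \<rho>) * g x powr (- \<rho>)) \<partial>unit_measure)
    \<le> ennreal (exp (2 * u\<^sup>2))"
proof -
  note [measurable] = g[unfolded density_on_unit_def, THEN conjunct1] g0[unfolded density_on_unit_def, THEN conjunct1]
  note I [simp] = density_on_unit_integrable[OF g] density_on_unit_integrable[OF g0]
  let ?d = "\<lambda>x. (1 + 2 * u\<^sup>2 + \<rho>) * g0 x - \<rho> * g x"
  have le: "g0 x powr (1 + \<rho>) * g x powr (- \<rho>) \<le> ?d x"
    if x: "0 \<le> x" "x \<le> 1" and near: "\<bar>ln (g x) - ln (g0 x)\<bar> \<le> u" for x
  proof -
    define t where "t = ln (g0 x) - ln (g x)"
    have t: "\<bar>t\<bar> \<le> u" using near by (simp add: t_def)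
    then have t2: "t\<^sup>2 \<le> u\<^sup>2" using abs_le_square_iff[of t u] u by simp
    have "exp (\<rho> * t) \<le> 1 + \<rho> * t + (\<rho> * t)\<^sup>2"
      using t u \<rho> by (intro exp_le_quadratic) (simp add: abs_mult mult_le_one)
    moreover have "(\<rho> * t)\<^sup>2 \<le> 1 * u\<^sup>2"
      unfolding power_mult_distrib using \<rho> t2 by (intro mult_mono) (auto intro: power_le_one)
    moreover have "\<rho> * exp (- t) \<le> \<rho> * (1 - t + t\<^sup>2)"
      using exp_le_quadratic[of "- t"] t u \<rho> by (intro mult_left_mono) auto
    moreover have "\<rho> * t\<^sup>2 \<le> 1 * u\<^sup>2"
      using \<rho> t2 by (intro mult_mono) auto
    \<comment> \<open>Adding the two expansions cancels the linear terms in \<open>t\<close>, and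
      each remaining square is at most u^2. After multiplication by \<open>g0\<close>, the term
      \<rho> * exp (- t) becomes \<rho> * g, whose integral is \<rho>.\<close>
    ultimately have *: "exp (\<rho> * t) \<le> 1 + 2 * u\<^sup>2 + \<rho> - \<rho> * exp (- t)"
      by (simp add: algebra_simps)
    have "g0 x powr (1 + \<rho>) * g x powr (- \<rho>) = g0 x * exp (\<rho> * t)"
      using pos[OF x] by (simp add: powr_def t_def exp_add exp_minus exp_diff right_diff_distrib distrib_right divide_inverse)
    also have "\<dots> \<le> g0 x * (1 + 2 * u\<^sup>2 + \<rho> - \<rho> * exp (- t))"
      using * pos[OF x] by (intro mult_left_mono) auto
    also have "\<dots> = ?d x"
      using pos[OF x] by (simp add: t_def exp_diff algebra_simps)
    finally show ?thesis .
  qed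
  have ae: "AE x in unit_measure. g0 x powr (1 + \<rho>) * g x powr (- \<rho>) \<le> ?d x"
    using near AE_space[of unit_measure] by eventually_elim (auto intro!: le simp: space_restrict_space)
  have d0: "AE x in unit_measure. 0 \<le> ?d x"
    using ae by eventually_elim (meson mult_nonneg_nonneg order_trans powr_ge_zero)
  have int: "integrable unit_measure ?d"
    by (intro Bochner_Integration.integrable_diff integrable_mult_right I)
  have "(\<integral>\<^sup>+x. ennreal (g0 x powr (1 + \<rho>) * g x powr (- \<rho>)) \<partial>unit_measure)
      \<le> (\<integral>\<^sup>+x. ennreal (?d x) \<partial>unit_measure)"
    using ae by (intro nn_integral_mono_AE) (auto intro: ennreal_leI)
  also have "\<dots> = ennreal (\<integral>x. ?d x \<partial>unit_measure)"
    by (intro nn_integral_eq_integral int d0)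
  also have "(\<integral>x. ?d x \<partial>unit_measure) = 1 + 2 * u\<^sup>2"
    by simp
  also have "\<dots> \<le> exp (2 * u\<^sup>2)"
    by (rule exp_ge_add_one_self)
  finally show ?thesis by (simp add: ennreal_leI)
qed

section \<open>Expected tempered posterior mass\<close>

text \<open>The quotient is at most 1 and at most a product x * y, where x and y are the two
  summands on the right. If x or y is at least 1 the first bound suffices; otherwise x * y \<le> x.
  The weight \<open>a\<close> stays free so that the two means can be balanced later.\<close>

lemma ennreal_divide_le_split:
  fixes N D I :: ennreal and a p :: real
  assumes "N \<le> D" "ennreal (p\<^sup>2) \<le> D * I" "0 < p" "0 < a"
  shows "N / D \<le> ennreal a * N + ennreal (1 / (a * p\<^sup>2)) * I"
proof -
  let ?e = "ennreal (1 / p\<^sup>2)"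
  have "0 < D"
    using assms(2,3) by (cases "D = 0") (auto simp: zero_less_iff_neq_zero ennreal_eq_0_iff)
  have one: "N / D \<le> 1"
    using assms(1) \<open>0 < D\<close> by (intro divide_le_posI_ennreal) auto
  \<comment> \<open>Insert the factor 1 as p^2 times its reciprocal, then enlarge p^2 to
    \<open>D * I\<close>; the factor \<open>D\<close> cancels against the denominator.\<close>
  have "N = N * (ennreal (p\<^sup>2) * ?e)"
    using assms(3) by (simp flip: ennreal_mult)
  also have "\<dots> \<le> N * (D * I * ?e)"
    by (intro mult_left_mono mult_right_mono assms) auto
  finally have "N / D \<le> N * (I * ?e)"
    by (intro divide_le_posI_ennreal \<open>0 < D\<close>) (simp add: ac_simps)
  also have "\<dots> = (ennreal a * N) * (ennreal (1 / (a * p\<^sup>2)) * I)"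
  proof -
    have "?e = ennreal a * ennreal (1 / (a * p\<^sup>2))"
      using assms by (subst ennreal_mult[symmetric]) auto
    then show ?thesis by (simp add: ac_simps)
  qed
  finally have prod: "N / D \<le> (ennreal a * N) * (ennreal (1 / (a * p\<^sup>2)) * I)" (is "_ \<le> ?x * ?y") .
  show ?thesis
  proof (cases "1 \<le> ?x \<or> 1 \<le> ?y")
    case True
    then show ?thesis using one by (auto intro: order_trans add_increasing add_increasing2)
  next
    case False
    then have "?x * ?y \<le> ?x * 1" by (intro mult_left_mono) auto
    then show ?thesis using prod by (auto intro: order_trans add_increasing2)
  qed
qed

text \<open>Replaces the reciprocal of the evidence by an integral of reciprocal likelihoods, whose mean under
  the sampling law is explicit.\<close>
lemma measure_sq_le_nn_integral_mult_inverse: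
  fixes f :: "'a \<Rightarrow> real"
  assumes "finite_measure M" and [measurable]: "f \<in> borel_measurable M" and A[measurable]: "A \<in> sets M"
    and pos: "\<And>\<omega>. \<omega> \<in> A \<Longrightarrow> 0 < f \<omega>"
  shows "ennreal ((measure M A)\<^sup>2) \<le>
    (\<integral>\<^sup>+\<omega>. ennreal (f \<omega>) \<partial>M) * (\<integral>\<^sup>+\<omega>. ennreal (1 / f \<omega>) * indicator A \<omega> \<partial>M)"
proof -
  interpret finite_measure M by fact
  \<comment> \<open>Cauchy-Schwarz is applied to the square root of \<open>f\<close> and its
    reciprocal, whose product on \<open>A\<close> is 1.\<close>
  let ?f = "\<lambda>\<omega>. ennreal (sqrt (f \<omega>)) * indicator A \<omega>"
  let ?g = "\<lambda>\<omega>. ennreal (1 / sqrt (f \<omega>)) * indicator A \<omega>"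
  have "ennreal ((measure M A)\<^sup>2) = (\<integral>\<^sup>+\<omega>. indicator A \<omega> \<partial>M)\<^sup>2"
    by (simp add: emeasure_eq_measure ennreal_power)
  also have "\<dots> = (\<integral>\<^sup>+\<omega>. ?f \<omega> * ?g \<omega> \<partial>M)\<^sup>2"
  proof (intro arg_cong[where f = "\<lambda>x. x\<^sup>2"] nn_integral_cong)
    fix \<omega>
    show "indicator A \<omega> = ?f \<omega> * ?g \<omega>"
      using pos[of \<omega>] by (auto split: split_indicator simp flip: ennreal_mult simp: ennreal_1[symmetric] simp del: ennreal_1)
  qed
  also have "\<dots> \<le> (\<integral>\<^sup>+\<omega>. (?f \<omega>)\<^sup>2 \<partial>M) * (\<integral>\<^sup>+\<omega>. (?g \<omega>)\<^sup>2 \<partial>M)"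
    by (intro Cauchy_Schwarz_nn_integral) auto
  also have "\<dots> \<le> (\<integral>\<^sup>+\<omega>. ennreal (f \<omega>) \<partial>M) * (\<integral>\<^sup>+\<omega>. ennreal (1 / f \<omega>) * indicator A \<omega> \<partial>M)"
    using pos by (intro mult_mono nn_integral_mono)
      (auto split: split_indicator simp: ennreal_power power_divide less_imp_le)
  finally show ?thesis .
qed

section \<open>Integrals under the sampling law\<close>

lemma prob_space_density_on_unit:
  assumes "density_on_unit g"
  shows "prob_space (density unit_measure (\<lambda>x. ennreal (g x)))"
proof (rule prob_spaceI)
  have [measurable]: "g \<in> borel_measurable unit_measure"
    using assms by (simp add: density_on_unit_def)
  have "emeasure (density unit_measure (\<lambda>x. ennreal (g x))) (space unit_measure)
      = (\<integral>\<^sup>+x. ennreal (g x) \<partial>unit_measure)"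
    using sets.top[of unit_measure] by (subst emeasure_density) (auto intro!: nn_integral_cong)
  then show "emeasure (density unit_measure (\<lambda>x. ennreal (g x)))
      (space (density unit_measure (\<lambda>x. ennreal (g x)))) = 1"
    using assms by (simp add: density_on_unit_def)
qed

lemma prob_space_sample_law: "density_on_unit g0 \<Longrightarrow> prob_space (sample_law g0 n)"
  unfolding sample_law_def by (intro prob_space_PiM prob_space_density_on_unit)

lemma space_sample_lawD: "X \<in> space (sample_law g0 n) \<Longrightarrow> i < n \<Longrightarrow> X i \<in> {0..1}"
  by (auto simp: sample_law_def space_PiM space_restrict_space PiE_def Pi_def)

text \<open>By independence the expectation of the product factorises into \<open>n\<close> copies
  of one integral. This carries the one-observation affinity bounds over to the whole
  sample.\<close>

lemma nn_integral_sample_law_prod: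
  assumes g0: "density_on_unit g0" and [measurable]: "q \<in> borel_measurable unit_measure"
    and q: "\<And>x. 0 \<le> x \<Longrightarrow> x \<le> 1 \<Longrightarrow> 0 \<le> q x"
    and le: "(\<integral>\<^sup>+x. ennreal (q x * g0 x) \<partial>unit_measure) \<le> ennreal c" and "0 \<le> c"
  shows "(\<integral>\<^sup>+X. ennreal (\<Prod>i<n. q (X i)) \<partial>sample_law g0 n) \<le> ennreal (c ^ n)"
proof -
  let ?D = "density unit_measure (\<lambda>x. ennreal (g0 x))"
  interpret D: prob_space ?D by (rule prob_space_density_on_unit[OF g0])
  interpret product_sigma_finite "\<lambda>_::nat. ?D" by standard
  have [measurable]: "g0 \<in> borel_measurable unit_measure"
    using g0 by (simp add: density_on_unit_def)
  have "(\<integral>\<^sup>+X. ennreal (\<Prod>i<n. q (X i)) \<partial>sample_law g0 n)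
      = (\<integral>\<^sup>+X. (\<Prod>i<n. ennreal (q (X i))) \<partial>sample_law g0 n)"
    using q by (intro nn_integral_cong, subst prod_ennreal) (auto dest: space_sample_lawD)
  also have "\<dots> = (\<Prod>i<n. \<integral>\<^sup>+x. ennreal (q x) \<partial>?D)"
    unfolding sample_law_def by (rule product_nn_integral_prod) auto
  also have "(\<integral>\<^sup>+x. ennreal (q x) \<partial>?D) = (\<integral>\<^sup>+x. ennreal (q x * g0 x) \<partial>unit_measure)"
  proof (subst nn_integral_density)
    show "(\<integral>\<^sup>+x. ennreal (g0 x) * ennreal (q x) \<partial>unit_measure) = (\<integral>\<^sup>+x. ennreal (q x * g0 x) \<partial>unit_measure)"
      using q g0 by (intro nn_integral_cong) (auto simp: density_on_unit_def space_restrict_space mult.commute simp flip: ennreal_mult)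
  qed auto
  also have "(\<Prod>i<n. \<dots>) \<le> (\<Prod>i<n. ennreal c)"
    using le by (intro prod_mono_ennreal)
  also have "\<dots> = ennreal (c ^ n)"
    using \<open>0 \<le> c\<close> by (simp add: ennreal_power)
  finally show ?thesis .
qed

text \<open>Dividing numerator and evidence by the tempered likelihood of \<open>g0\<close> leaves
  their quotient unchanged and produces products of likelihood ratios. The quotient is split with
  weight \<open>a\<close>, and Fubini reduces each half to a one-observation affinity: the tempered
  one on \<open>B\<close>, the inverse one on \<open>A\<close>.\<close>

lemma nn_integral_tempered_posterior_le:
  fixes G :: "'w \<Rightarrow> real \<Rightarrow> real"
  assumes P: "prob_space P"
    and pair: "(\<lambda>(\<omega>, x). G \<omega> x) \<in> borel_measurable (P \<Otimes>\<^sub>M unit_measure)"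
    and g0: "density_on_unit g0" "\<And>x. 0 \<le> x \<Longrightarrow> x \<le> 1 \<Longrightarrow> 0 < g0 x"
    and \<rho>: "0 < \<rho>" "\<rho> < 1" and r: "0 < r" and a: "0 < a"
    and G: "\<And>\<omega>. \<omega> \<in> space P \<Longrightarrow> density_on_unit (G \<omega>) \<or> (\<forall>x. G \<omega> x = 0)"
    and B[measurable]: "B \<in> sets P" and far: "\<And>\<omega>. \<omega> \<in> B \<Longrightarrow> L1_norm (\<lambda>x. G \<omega> x - g0 x) > ennreal r"
    and A[measurable]: "A \<in> sets P" and A0: "0 < measure P A"
    and u: "0 \<le> u" "u \<le> 1"
    and near: "\<And>\<omega>. \<omega> \<in> A \<Longrightarrow> density_on_unit (G \<omega>)"
      "\<And>\<omega> x. \<omega> \<in> A \<Longrightarrow> 0 \<le> x \<Longrightarrow> x \<le> 1 \<Longrightarrow> 0 < G \<omega> x"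
      "\<And>\<omega>. \<omega> \<in> A \<Longrightarrow> AE x in unit_measure. \<bar>ln (G \<omega> x) - ln (g0 x)\<bar> \<le> u"
  shows "(\<integral>\<^sup>+X. (\<integral>\<^sup>+\<omega>. ennreal ((\<Prod>i<n. G \<omega> (X i)) powr \<rho>) * indicator B \<omega> \<partial>P) /
      (\<integral>\<^sup>+\<omega>. ennreal ((\<Prod>i<n. G \<omega> (X i)) powr \<rho>) \<partial>P) \<partial>sample_law g0 n)
    \<le> ennreal (a * exp (- (real n * (min \<rho> (1 - \<rho>) * r\<^sup>2 / 4)))
        + exp (real n * (2 * u\<^sup>2)) / (a * measure P A))"
proof -
  interpret P: prob_space P by (rule P)
  interpret S: prob_space "sample_law g0 n" by (rule prob_space_sample_law[OF g0(1)])
  interpret SP: pair_sigma_finite "sample_law g0 n" P ..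
  let ?S = "PiM {..<n} (\<lambda>_. unit_measure)"
  have sets_S: "sets (sample_law g0 n) = sets ?S"
    unfolding sample_law_def by (intro sets_PiM_cong) auto
  have [measurable]: "g0 \<in> borel_measurable unit_measure"
    using g0 by (simp add: density_on_unit_def)
  have G_meas: "G \<omega> \<in> borel_measurable unit_measure" if "\<omega> \<in> space P" for \<omega>
    using measurable_compose[OF measurable_Pair1' pair, OF that] by simp
  have G_ge: "0 \<le> G \<omega> x" if "\<omega> \<in> space P" "0 \<le> x" "x \<le> 1" for \<omega> x
    using G[OF that(1)] that by (auto simp: density_on_unit_def)
  \<comment> \<open>The tempered likelihood ratio of one observation. Its mean under
    \<open>g0\<close> is the tempered affinity, and the mean of its reciprocal is the inverse
    affinity.\<close>
  define q where "q \<omega> x = G \<omega> x powr \<rho> * g0 x powr (- \<rho>)" for \<omega> x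
  have q_ge: "0 \<le> q \<omega> x" for \<omega> x by (simp add: q_def)
  have comp: "(\<lambda>z. q (snd z) (fst z i)) \<in> borel_measurable (sample_law g0 n \<Otimes>\<^sub>M P)" if "i < n" for i
  proof -
    have "(\<lambda>z. (snd z, fst z i)) \<in> (?S \<Otimes>\<^sub>M P) \<rightarrow>\<^sub>M (P \<Otimes>\<^sub>M unit_measure)"
      using that by (intro measurable_Pair measurable_snd
        measurable_compose[OF measurable_fst measurable_component_singleton]) auto
    moreover have "(\<lambda>z. q (fst z) (snd z)) \<in> borel_measurable (P \<Otimes>\<^sub>M unit_measure)"
      using pair unfolding q_def by (simp add: case_prod_beta')
    ultimately have "(\<lambda>z. q (snd z) (fst z i)) \<in> borel_measurable (?S \<Otimes>\<^sub>M P)"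
      using measurable_compose[of "\<lambda>z. (snd z, fst z i)" "?S \<Otimes>\<^sub>M P" "P \<Otimes>\<^sub>M unit_measure" "\<lambda>z. q (fst z) (snd z)"] by simp
    then show ?thesis
      by (subst measurable_cong_sets[OF sets_pair_measure_cong[OF sets_S refl] refl])
  qed
  define \<Lambda> where "\<Lambda> X \<omega> = (\<Prod>i<n. q \<omega> (X i))" for X \<omega>
  have \<Lambda>_meas[measurable]: "(\<lambda>(X, \<omega>). \<Lambda> X \<omega>) \<in> borel_measurable (sample_law g0 n \<Otimes>\<^sub>M P)"
    unfolding \<Lambda>_def case_prod_beta' using comp by (intro borel_measurable_prod) auto
  have \<Lambda>_ge: "0 \<le> \<Lambda> X \<omega>" for X \<omega> unfolding \<Lambda>_def by (intro prod_nonneg q_ge ballI)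
  let ?N = "\<lambda>X. \<integral>\<^sup>+\<omega>. ennreal (\<Lambda> X \<omega>) * indicator B \<omega> \<partial>P"
  let ?D = "\<lambda>X. \<integral>\<^sup>+\<omega>. ennreal (\<Lambda> X \<omega>) \<partial>P"
  let ?I = "\<lambda>X. \<integral>\<^sup>+\<omega>. ennreal (1 / \<Lambda> X \<omega>) * indicator A \<omega> \<partial>P"
  let ?p = "measure P A"
  have ratio: "(\<integral>\<^sup>+\<omega>. ennreal ((\<Prod>i<n. G \<omega> (X i)) powr \<rho>) * indicator B \<omega> \<partial>P) /
      (\<integral>\<^sup>+\<omega>. ennreal ((\<Prod>i<n. G \<omega> (X i)) powr \<rho>) \<partial>P)
      \<le> ennreal a * ?N X + ennreal (1 / (a * ?p\<^sup>2)) * ?I X" if X: "X \<in> space (sample_law g0 n)" for X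
  proof -
    \<comment> \<open>The tempered likelihood of \<open>g0\<close> does not depend on \<omega>, so
      it comes out of both integrals; being positive and finite, it cancels.\<close>
    define W where "W = (\<Prod>i<n. g0 (X i) powr \<rho>)"
    have W: "0 < W"
      unfolding W_def using space_sample_lawD[OF X] g0(2) by (intro prod_pos) (force simp: powr_gt_zero)
    have [measurable]: "(\<lambda>\<omega>. \<Lambda> X \<omega>) \<in> borel_measurable P"
      using measurable_compose[OF measurable_Pair1' \<Lambda>_meas, OF X] by simp
    have eq: "ennreal ((\<Prod>i<n. G \<omega> (X i)) powr \<rho>) = ennreal (\<Lambda> X \<omega>) * ennreal W" if "\<omega> \<in> space P" for \<omega>
    proof -
      have "(\<Prod>i<n. G \<omega> (X i)) powr \<rho> = (\<Prod>i<n. G \<omega> (X i) powr \<rho>)"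
        using G_ge[OF that] space_sample_lawD[OF X] by (subst prod_powr_distrib) auto
      also have "\<dots> = (\<Prod>i<n. q \<omega> (X i) * g0 (X i) powr \<rho>)"
      proof (rule prod.cong)
        fix i assume "i \<in> {..<n}"
        then have "0 < g0 (X i)" using space_sample_lawD[OF X] g0(2) by auto
        then show "G \<omega> (X i) powr \<rho> = q \<omega> (X i) * g0 (X i) powr \<rho>"
          by (simp add: q_def mult.assoc flip: powr_add)
      qed simp
      finally show ?thesis
        using W \<Lambda>_ge by (simp add: prod.distrib \<Lambda>_def[symmetric] W_def[symmetric] ennreal_mult)
    qed
    have num: "(\<integral>\<^sup>+\<omega>. ennreal ((\<Prod>i<n. G \<omega> (X i)) powr \<rho>) * indicator B \<omega> \<partial>P) = ?N X * ennreal W"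
      by (subst nn_integral_multc[symmetric]) (auto intro!: nn_integral_cong simp: eq ac_simps)
    have den: "(\<integral>\<^sup>+\<omega>. ennreal ((\<Prod>i<n. G \<omega> (X i)) powr \<rho>) \<partial>P) = ?D X * ennreal W"
      by (subst nn_integral_multc[symmetric]) (auto intro!: nn_integral_cong simp: eq)
    have "?N X * ennreal W / (?D X * ennreal W) = ?N X / ?D X"
      using W by (intro divide_mult_eq) auto
    moreover have "?N X / ?D X \<le> ennreal a * ?N X + ennreal (1 / (a * ?p\<^sup>2)) * ?I X"
    proof (rule ennreal_divide_le_split[OF _ _ A0 a])
      show "?N X \<le> ?D X"
        by (intro nn_integral_mono) (auto split: split_indicator)
      show "ennreal (?p\<^sup>2) \<le> ?D X * ?I X"
      proof (rule measure_sq_le_nn_integral_mult_inverse)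
        show "0 < \<Lambda> X \<omega>" if "\<omega> \<in> A" for \<omega>
        proof -
          have "0 < q \<omega> (X i)" if "i < n" for i
          proof -
            have "0 < G \<omega> (X i)" "0 < g0 (X i)"
              using near(2)[OF \<open>\<omega> \<in> A\<close>] g0(2) space_sample_lawD[OF X that] by auto
            then show ?thesis by (simp add: q_def)
          qed
          then show ?thesis unfolding \<Lambda>_def by (intro prod_pos) auto
        qed
      qed (auto intro: P.finite_measure_axioms)
    qed
    ultimately show ?thesis unfolding num den by simp
  qed
  have N_meas[measurable]: "?N \<in> borel_measurable (sample_law g0 n)"
    and I_meas[measurable]: "?I \<in> borel_measurable (sample_law g0 n)"
    by (measurable, measurable)
  have IN: "(\<integral>\<^sup>+X. ?N X \<partial>sample_law g0 n) \<le> ennreal (exp (- (min \<rho> (1 - \<rho>) * r\<^sup>2 / 4)) ^ n)" (is "_ \<le> ennreal (?c ^ n)")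
  proof -
    have "(\<integral>\<^sup>+X. ?N X \<partial>sample_law g0 n)
        = (\<integral>\<^sup>+\<omega>. \<integral>\<^sup>+X. ennreal (\<Lambda> X \<omega>) * indicator B \<omega> \<partial>sample_law g0 n \<partial>P)"
      by (rule SP.Fubini'[symmetric]) measurable
    also have "\<dots> \<le> (\<integral>\<^sup>+\<omega>. ennreal (?c ^ n) \<partial>P)"
    proof (intro nn_integral_mono)
      fix \<omega> assume \<omega>: "\<omega> \<in> space P"
      have "(\<integral>\<^sup>+X. ennreal (\<Lambda> X \<omega>) \<partial>sample_law g0 n) \<le> ennreal (?c ^ n)" if "\<omega> \<in> B"
        unfolding \<Lambda>_def
      proof (rule nn_integral_sample_law_prod[OF g0(1)])
        show "q \<omega> \<in> borel_measurable unit_measure"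
          using G_meas[OF \<omega>] unfolding q_def by measurable
        have "(\<integral>\<^sup>+x. ennreal (q \<omega> x * g0 x) \<partial>unit_measure)
            = (\<integral>\<^sup>+x. ennreal (G \<omega> x powr \<rho> * g0 x powr (1 - \<rho>)) \<partial>unit_measure)"
          using g0(2) by (intro nn_integral_cong)
            (auto simp: q_def space_restrict_space powr_diff powr_minus divide_inverse abs_of_pos ac_simps)
        \<comment> \<open>If the random function vanishes identically, then so does the integrand,
          because \<rho> is positive and 0 powr \<rho> is 0. Otherwise it is a density far from
          \<open>g0\<close>.\<close>
        also have "\<dots> \<le> ennreal ?c"
        proof (cases "\<forall>x. G \<omega> x = 0")
          case False
          then show ?thesis
            using G[OF \<omega>] by (intro tempered_affinity_le g0(1) \<rho> r far that) auto
        qed (use \<rho> in auto)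
        finally show "(\<integral>\<^sup>+x. ennreal (q \<omega> x * g0 x) \<partial>unit_measure) \<le> ennreal ?c" .
      qed (auto simp: q_ge)
      then show "(\<integral>\<^sup>+X. ennreal (\<Lambda> X \<omega>) * indicator B \<omega> \<partial>sample_law g0 n) \<le> ennreal (?c ^ n)"
        by (cases "\<omega> \<in> B") auto
    qed
    also have "\<dots> = ennreal (?c ^ n)" by (simp add: P.emeasure_space_1)
    finally show ?thesis .
  qed
  \<comment> \<open>Keeping the indicator of \<open>A\<close> yields one factor \<open>?p\<close>,
    which cancels one of the two powers of \<open>?p\<close> coming from Cauchy-Schwarz.\<close>
  have II: "(\<integral>\<^sup>+X. ?I X \<partial>sample_law g0 n) \<le> ennreal (exp (2 * u\<^sup>2) ^ n) * ennreal ?p"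
  proof -
    have "(\<integral>\<^sup>+X. ?I X \<partial>sample_law g0 n)
        = (\<integral>\<^sup>+\<omega>. \<integral>\<^sup>+X. ennreal (1 / \<Lambda> X \<omega>) * indicator A \<omega> \<partial>sample_law g0 n \<partial>P)"
      by (rule SP.Fubini'[symmetric]) measurable
    also have "\<dots> \<le> (\<integral>\<^sup>+\<omega>. ennreal (exp (2 * u\<^sup>2) ^ n) * indicator A \<omega> \<partial>P)"
    proof (intro nn_integral_mono)
      fix \<omega> assume \<omega>: "\<omega> \<in> space P"
      have "(\<integral>\<^sup>+X. ennreal (1 / \<Lambda> X \<omega>) \<partial>sample_law g0 n) \<le> ennreal (exp (2 * u\<^sup>2) ^ n)" if "\<omega> \<in> A"
      proof -
        have "(\<integral>\<^sup>+X. ennreal (\<Prod>i<n. 1 / q \<omega> (X i)) \<partial>sample_law g0 n) \<le> ennreal (exp (2 * u\<^sup>2) ^ n)"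
        proof (rule nn_integral_sample_law_prod[OF g0(1)])
          show "(\<lambda>x. 1 / q \<omega> x) \<in> borel_measurable unit_measure"
            using G_meas[OF \<omega>] unfolding q_def by measurable
          have "(\<integral>\<^sup>+x. ennreal (1 / q \<omega> x * g0 x) \<partial>unit_measure)
              = (\<integral>\<^sup>+x. ennreal (g0 x powr (1 + \<rho>) * G \<omega> x powr (- \<rho>)) \<partial>unit_measure)"
            using g0(2) by (intro nn_integral_cong)
              (auto simp: q_def space_restrict_space powr_add powr_minus divide_inverse abs_of_pos ac_simps)
          also have "\<dots> \<le> ennreal (exp (2 * u\<^sup>2))"
            using near that by (intro inverse_tempered_affinity_le g0 \<rho> u) auto
          finally show "(\<integral>\<^sup>+x. ennreal (1 / q \<omega> x * g0 x) \<partial>unit_measure) \<le> ennreal (exp (2 * u\<^sup>2))" .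
        qed (auto simp: q_ge)
        then show ?thesis by (simp add: \<Lambda>_def prod_dividef)
      qed
      then show "(\<integral>\<^sup>+X. ennreal (1 / \<Lambda> X \<omega>) * indicator A \<omega> \<partial>sample_law g0 n)
          \<le> ennreal (exp (2 * u\<^sup>2) ^ n) * indicator A \<omega>"
        by (cases "\<omega> \<in> A") auto
    qed
    also have "\<dots> = ennreal (exp (2 * u\<^sup>2) ^ n) * ennreal ?p"
      by (simp add: nn_integral_cmult_indicator P.emeasure_eq_measure)
    finally show ?thesis .
  qed
  have "(\<integral>\<^sup>+X. (\<integral>\<^sup>+\<omega>. ennreal ((\<Prod>i<n. G \<omega> (X i)) powr \<rho>) * indicator B \<omega> \<partial>P) /
      (\<integral>\<^sup>+\<omega>. ennreal ((\<Prod>i<n. G \<omega> (X i)) powr \<rho>) \<partial>P) \<partial>sample_law g0 n)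
      \<le> (\<integral>\<^sup>+X. ennreal a * ?N X + ennreal (1 / (a * ?p\<^sup>2)) * ?I X \<partial>sample_law g0 n)"
    by (intro nn_integral_mono ratio)
  also have "\<dots> = ennreal a * (\<integral>\<^sup>+X. ?N X \<partial>sample_law g0 n)
      + ennreal (1 / (a * ?p\<^sup>2)) * (\<integral>\<^sup>+X. ?I X \<partial>sample_law g0 n)"
    by (simp add: nn_integral_add nn_integral_cmult)
  also have "\<dots> \<le> ennreal a * ennreal (?c ^ n)
      + ennreal (1 / (a * ?p\<^sup>2)) * (ennreal (exp (2 * u\<^sup>2) ^ n) * ennreal ?p)"
    by (intro add_mono mult_left_mono IN II) auto
  also have "\<dots> = ennreal (a * ?c ^ n + 1 / (a * ?p\<^sup>2) * (exp (2 * u\<^sup>2) ^ n * ?p))"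
    using a by (simp flip: ennreal_mult ennreal_plus)
  also have "a * ?c ^ n + 1 / (a * ?p\<^sup>2) * (exp (2 * u\<^sup>2) ^ n * ?p)
      = a * exp (- (real n * (min \<rho> (1 - \<rho>) * r\<^sup>2 / 4))) + exp (real n * (2 * u\<^sup>2)) / (a * ?p)"
    using a A0 by (simp add: power2_eq_square flip: exp_of_nat_mult)
  finally show ?thesis .
qed

section \<open>Exponentiated wavelet series\<close>

lemma prob_space_unit_measure: "prob_space unit_measure"
  by (rule prob_spaceI) (simp add: space_restrict_space emeasure_restrict_space)

lemma integral_exp_pos:
  fixes f :: "real \<Rightarrow> real"
  assumes [measurable]: "f \<in> borel_measurable unit_measure" and int: "integrable unit_measure (\<lambda>x. exp (f x))"
  shows "0 < (\<integral>x. exp (f x) \<partial>unit_measure)"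
proof -
  interpret prob_space unit_measure by (rule prob_space_unit_measure)
  have "(\<integral>x. exp (f x) \<partial>unit_measure) \<noteq> 0"
    using integral_nonneg_eq_0_iff_AE[OF int] by (simp add: AE_False)
  moreover have "0 \<le> (\<integral>x. exp (f x) \<partial>unit_measure)" by simp
  ultimately show ?thesis by linarith
qed

lemma density_on_unit_exp_density:
  assumes [measurable]: "f \<in> borel_measurable unit_measure" and int: "integrable unit_measure (\<lambda>x. exp (f x))"
  shows "density_on_unit (exp_density f)"
proof -
  let ?I = "\<integral>x. exp (f x) \<partial>unit_measure"
  have I: "0 < ?I" by (rule integral_exp_pos[OF assms])
  have "(\<integral>\<^sup>+x. ennreal (exp_density f x) \<partial>unit_measure) = ennreal (\<integral>x. exp_density f x \<partial>unit_measure)"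
    unfolding exp_density_def using int I
    by (intro nn_integral_eq_integral) auto
  also have "(\<integral>x. exp_density f x \<partial>unit_measure) = 1"
    using I by (simp add: exp_density_def)
  finally show ?thesis
    using I unfolding density_on_unit_def
    by (auto simp: exp_density_def[abs_def])
qed

text \<open>If \<open>exp f\<close> is not integrable, its Bochner integral is \<open>0\<close> and so is the quotient.\<close>
lemma exp_density_cases:
  assumes "f \<in> borel_measurable unit_measure"
  shows "density_on_unit (exp_density f) \<or> (\<forall>x. exp_density f x = 0)"
  using density_on_unit_exp_density[OF assms]
  by (cases "integrable unit_measure (\<lambda>x. exp (f x))") (auto simp: exp_density_def not_integrable_integral_eq)

text \<open>Since \<open>g0\<close> has mass one, the normalising integral lies between exp (-
  \<eta>) and exp \<eta>. Its logarithm shifts the log-density by at most another \<eta>, whence the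
  factor 2.\<close>

lemma exp_density_near:
  assumes g0: "density_on_unit g0" and pos: "\<And>x. 0 \<le> x \<Longrightarrow> x \<le> 1 \<Longrightarrow> 0 < g0 x"
    and f[measurable]: "f \<in> borel_measurable unit_measure"
    and near: "AE x in unit_measure. \<bar>f x - ln (g0 x)\<bar> \<le> \<eta>"
  shows "density_on_unit (exp_density f)" "0 < exp_density f x"
    "AE x in unit_measure. \<bar>ln (exp_density f x) - ln (g0 x)\<bar> \<le> 2 * \<eta>"
proof -
  interpret prob_space unit_measure by (rule prob_space_unit_measure)
  note I = density_on_unit_integrable[OF g0]
  let ?I = "\<integral>x. exp (f x) \<partial>unit_measure"
  have ae: "AE x in unit_measure. 0 < g0 x"
    by (intro AE_unit_measureI pos)
  have up: "AE x in unit_measure. exp (f x) \<le> exp \<eta> * g0 x"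
    using near ae
  proof eventually_elim
    case (elim x)
    then have "exp (f x) \<le> exp (\<eta> + ln (g0 x))" by simp
    then show ?case using elim by (simp add: exp_add)
  qed
  have lo: "AE x in unit_measure. exp (- \<eta>) * g0 x \<le> exp (f x)"
    using near ae
  proof eventually_elim
    case (elim x)
    then have "exp (- \<eta> + ln (g0 x)) \<le> exp (f x)" by simp
    then show ?case using elim by (simp add: exp_add exp_diff exp_minus divide_inverse ac_simps)
  qed
  have int: "integrable unit_measure (\<lambda>x. exp (f x))"
  proof (rule Bochner_Integration.integrable_bound)
    show "integrable unit_measure (\<lambda>x. exp \<eta> * g0 x)" using I by simp
    show "AE x in unit_measure. norm (exp (f x)) \<le> norm (exp \<eta> * g0 x)"
      using up by eventually_elim auto
  qed measurable
  have "?I \<le> (\<integral>x. exp \<eta> * g0 x \<partial>unit_measure)"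
    using I by (intro integral_mono_AE int up) auto
  then have I_up: "?I \<le> exp \<eta>" using I by simp
  have "(\<integral>x. exp (- \<eta>) * g0 x \<partial>unit_measure) \<le> ?I"
    using I by (intro integral_mono_AE int lo) auto
  then have I_lo: "exp (- \<eta>) \<le> ?I" using I by simp
  have I_pos: "0 < ?I" by (rule integral_exp_pos[OF f int])
  have ln_I: "\<bar>ln ?I\<bar> \<le> \<eta>"
    using ln_mono[OF I_up I_pos] ln_mono[OF I_lo] by simp
  show "density_on_unit (exp_density f)" by (rule density_on_unit_exp_density[OF f int])
  show "0 < exp_density f x" using I_pos by (simp add: exp_density_def)
  have "ln (exp_density f x) = f x - ln ?I" for x
    using I_pos by (simp add: exp_density_def ln_div)
  then show "AE x in unit_measure. \<bar>ln (exp_density f x) - ln (g0 x)\<bar> \<le> 2 * \<eta>"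
    using near ln_I by (auto elim!: eventually_mono)
qed

lemma integrable_power2_diff_bounded:
  fixes f u :: "'a \<Rightarrow> real"
  assumes "finite_measure M" and [measurable]: "f \<in> borel_measurable M" "u \<in> borel_measurable M"
    and int: "integrable M (\<lambda>x. (f x)\<^sup>2)" and u: "\<And>x. x \<in> space M \<Longrightarrow> \<bar>u x\<bar> \<le> c"
  shows "integrable M (\<lambda>x. (f x - u x)\<^sup>2)"
proof -
  interpret finite_measure M by fact
  show ?thesis
  proof (rule Bochner_Integration.integrable_bound)
    show "integrable M (\<lambda>x. 2 * (f x)\<^sup>2 + 2 * c\<^sup>2)" using int by simp
    show "AE x in M. norm ((f x - u x)\<^sup>2) \<le> norm (2 * (f x)\<^sup>2 + 2 * c\<^sup>2)"
    proof (rule AE_I2)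
      fix x assume x: "x \<in> space M"
      have "(u x)\<^sup>2 \<le> c\<^sup>2" using u[OF x] by (simp add: abs_le_square_iff[symmetric])
      moreover have "(f x - u x)\<^sup>2 \<le> 2 * (f x)\<^sup>2 + 2 * (u x)\<^sup>2"
        using zero_le_power2[of "f x + u x"] by (simp add: power2_sum power2_diff)
      ultimately show "norm ((f x - u x)\<^sup>2) \<le> norm (2 * (f x)\<^sup>2 + 2 * c\<^sup>2)"
        by simp
    qed
  qed measurable
qed

section \<open>Uniform convergence of wavelet series\<close>

lemma wavelet_basis_measurable:
  assumes "wavelet_basis \<psi>" "k \<in> K l"
  shows "\<psi> l k \<in> borel_measurable unit_measure"
  using assms by (auto simp: wavelet_basis_def orthonormal_basis_L2_def square_integrable_def)

lemma wavelet_series_measurable: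
  assumes "wavelet_basis \<psi>"
  shows "wavelet_series \<psi> a \<in> borel_measurable unit_measure"
  unfolding wavelet_series_def[abs_def]
  using wavelet_basis_measurable[OF assms]
  by (intro borel_measurable_suminf borel_measurable_sum borel_measurable_times) auto

text \<open>Both sides are tails: the tail of \<open>b\<close> is dominated by that of the majorant.
  The bound depends on \<open>M\<close> only, so applied to functions it is uniform in the
  point.\<close>

lemma suminf_diff_partial_sum_le:
  fixes b :: "nat \<Rightarrow> real"
  assumes M: "summable M" and b: "\<And>l. \<bar>b l\<bar> \<le> M l"
  shows "\<bar>(\<Sum>l. b l) - (\<Sum>l<N. b l)\<bar> \<le> (\<Sum>l. M l) - (\<Sum>l<N. M l)"
proof -
  have b_abs: "summable (\<lambda>l. \<bar>b l\<bar>)"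
    by (rule summable_comparison_test'[OF M, of 0]) (use b in auto)
  note bs = summable_rabs_cancel[OF b_abs]
  have "\<bar>\<Sum>l. b (l + N)\<bar> \<le> (\<Sum>l. \<bar>b (l + N)\<bar>)"
    using b_abs by (intro summable_rabs summable_ignore_initial_segment)
  also have "\<dots> \<le> (\<Sum>l. M (l + N))"
    using b_abs M b by (intro suminf_le summable_ignore_initial_segment)
  finally show ?thesis
    using suminf_minus_initial_segment[OF bs] suminf_minus_initial_segment[OF M] by simp
qed

text \<open>The partial sums converge to \<open>f\<close> in mean square by completeness of the
  basis, and uniformly to the pointwise series by the Weierstrass test. The two limits therefore
  agree almost everywhere.\<close>

lemma wavelet_series_inner_L2_AE_eq:
  assumes basis: "wavelet_basis \<psi>" and f: "square_integrable f" and M: "summable M"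
    and le: "\<And>l x. 0 \<le> x \<Longrightarrow> x \<le> 1 \<Longrightarrow> \<bar>\<Sum>k\<in>K l. inner_L2 f (\<psi> l k) * \<psi> l k x\<bar> \<le> M l"
  shows "AE x in unit_measure. wavelet_series \<psi> (\<lambda>l k. inner_L2 f (\<psi> l k)) x = f x"
proof -
  interpret prob_space unit_measure by (rule prob_space_unit_measure)
  let ?a = "\<lambda>l k. inner_L2 f (\<psi> l k)"
  define F where "F = wavelet_series \<psi> ?a"
  define S where "S N x = (\<Sum>l<N. \<Sum>k\<in>K l. ?a l k * \<psi> l k x)" for N x
  define T where "T N = (\<Sum>l. M l) - (\<Sum>l<N. M l)" for N
  have [measurable]: "f \<in> borel_measurable unit_measure" and f2: "integrable unit_measure (\<lambda>x. (f x)\<^sup>2)"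
    using f by (auto simp: square_integrable_def)
  have [measurable]: "F \<in> borel_measurable unit_measure"
    unfolding F_def by (rule wavelet_series_measurable[OF basis])
  have [measurable]: "S N \<in> borel_measurable unit_measure" for N
    unfolding S_def[abs_def] using wavelet_basis_measurable[OF basis]
    by (intro borel_measurable_sum borel_measurable_times) auto
  have diff: "\<bar>F x - S N x\<bar> \<le> T N" if "x \<in> {0..1}" for N x
    using suminf_diff_partial_sum_le[OF M, of "\<lambda>l. \<Sum>k\<in>K l. ?a l k * \<psi> l k x" N] le[of x] that
    by (simp add: F_def S_def T_def wavelet_series_def)
  have F_bd: "\<bar>F x\<bar> \<le> T 0" if "x \<in> {0..1}" for x
    using diff[OF that, of 0] by (simp add: S_def)
  have S_bd: "\<bar>S N x\<bar> \<le> T 0 + T N" if "x \<in> {0..1}" for x N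
    using diff[OF that, of N] F_bd[OF that] by linarith
  have fF: "integrable unit_measure (\<lambda>x. (f x - F x)\<^sup>2)"
    using F_bd by (intro integrable_power2_diff_bounded[where c = "T 0"] f2 finite_measure_axioms)
      (auto simp: space_restrict_space)
  have fS: "integrable unit_measure (\<lambda>x. (f x - S N x)\<^sup>2)" for N
    using S_bd by (intro integrable_power2_diff_bounded[where c = "T 0 + T N"] f2 finite_measure_axioms)
      (auto simp: space_restrict_space)
  \<comment> \<open>The left side does not involve \<open>N\<close>, while both terms on the right
    tend to 0: the first by completeness, the second as a tail of the majorant.\<close>
  have "(\<integral>x. (f x - F x)\<^sup>2 \<partial>unit_measure) \<le> 2 * (\<integral>x. (f x - S N x)\<^sup>2 \<partial>unit_measure) + 2 * (T N)\<^sup>2" for N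
  proof -
    have "(\<integral>x. (f x - F x)\<^sup>2 \<partial>unit_measure) \<le> (\<integral>x. 2 * (f x - S N x)\<^sup>2 + 2 * (T N)\<^sup>2 \<partial>unit_measure)"
    proof (intro integral_mono fF Bochner_Integration.integrable_add integrable_mult_right fS)
      fix x assume "x \<in> space unit_measure"
      then have "(F x - S N x)\<^sup>2 \<le> (T N)\<^sup>2"
        using diff[of x N] by (simp add: abs_le_square_iff[symmetric] space_restrict_space)
      moreover have "(f x - F x)\<^sup>2 \<le> 2 * (f x - S N x)\<^sup>2 + 2 * (F x - S N x)\<^sup>2"
        using zero_le_power2[of "(f x - S N x) + (F x - S N x)"]
        by (simp add: power2_eq_square algebra_simps)
      ultimately show "(f x - F x)\<^sup>2 \<le> 2 * (f x - S N x)\<^sup>2 + 2 * (T N)\<^sup>2" by linarith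
    qed simp
    also have "\<dots> = 2 * (\<integral>x. (f x - S N x)\<^sup>2 \<partial>unit_measure) + 2 * (T N)\<^sup>2"
      using fS prob_space by simp
    finally show ?thesis .
  qed
  moreover have "(\<lambda>N. 2 * (\<integral>x. (f x - S N x)\<^sup>2 \<partial>unit_measure) + 2 * (T N)\<^sup>2) \<longlonglongrightarrow> 2 * 0 + 2 * 0\<^sup>2"
  proof (intro tendsto_intros)
    show "(\<lambda>N. \<integral>x. (f x - S N x)\<^sup>2 \<partial>unit_measure) \<longlonglongrightarrow> 0"
      using basis f by (simp add: wavelet_basis_def orthonormal_basis_L2_def S_def)
    have "T \<longlonglongrightarrow> (\<Sum>l. M l) - (\<Sum>l. M l)"
      unfolding T_def[abs_def] by (intro tendsto_intros summable_LIMSEQ M)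
    then show "T \<longlonglongrightarrow> 0" by simp
  qed
  ultimately have "(\<integral>x. (f x - F x)\<^sup>2 \<partial>unit_measure) \<le> 2 * 0 + 2 * 0\<^sup>2"
    by (intro LIMSEQ_le_const) auto
  moreover have "0 \<le> (\<integral>x. (f x - F x)\<^sup>2 \<partial>unit_measure)" by simp
  ultimately have "(\<integral>x. (f x - F x)\<^sup>2 \<partial>unit_measure) = 0" by simp
  then have "AE x in unit_measure. (f x - F x)\<^sup>2 = 0"
    by (subst (asm) integral_nonneg_eq_0_iff_AE[OF fF]) auto
  then show ?thesis by (auto simp: F_def)
qed

section \<open>Prior mass of sup-norm balls\<close>

lemma density_on_real_integrable:
  assumes "density_on_real h"
  shows "integrable lborel h" "(\<integral>x. h x \<partial>lborel) = 1"
proof -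
  have "has_bochner_integral lborel h 1"
    using assms unfolding density_on_real_def
    by (intro has_bochner_integral_nn_integral) auto
  then show "integrable lborel h" "(\<integral>x. h x \<partial>lborel) = 1"
    by (auto simp: has_bochner_integral_iff)
qed

lemma density_on_real_set_integrable:
  assumes "density_on_real h" "S \<in> sets borel"
  shows "set_integrable lborel S h"
  using set_integrable_subset[of lborel UNIV h S] density_on_real_integrable[OF assms(1)] assms(2)
  by (auto simp: set_integrable_def)

lemma density_on_real_set_integral_mono:
  assumes "density_on_real h" "S \<in> sets borel" "T \<in> sets borel" "S \<subseteq> T"
  shows "(LINT x:S|lborel. h x) \<le> (LINT x:T|lborel. h x)"
  unfolding set_lebesgue_integral_def
  using density_on_real_set_integrable[OF assms(1,2)] density_on_real_set_integrable[OF assms(1,3)] assms(1,4)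
  by (intro integral_mono)
    (auto simp: set_integrable_def density_on_real_def split: split_indicator)

lemma prob_distributed_eq_set_integral:
  assumes P: "prob_space P" and h: "density_on_real h"
    and X: "distributed P lborel X (\<lambda>x. ennreal (h x))" and S: "S \<in> sets borel"
  shows "measure P (X -` S \<inter> space P) = (LINT x:S|lborel. h x)"
proof -
  interpret prob_space P by (rule P)
  have S': "S \<in> sets lborel" using S by simp
  have "emeasure P (X -` S \<inter> space P) = (\<integral>\<^sup>+x. ennreal (h x) * indicator S x \<partial>lborel)"
    by (rule distributed_emeasure[OF X S'])
  also have "\<dots> = (\<integral>\<^sup>+x. ennreal (indicator S x *\<^sub>R h x) \<partial>lborel)"
    by (intro nn_integral_cong) (auto split: split_indicator)
  also have "\<dots> = ennreal (LINT x:S|lborel. h x)"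
    unfolding set_lebesgue_integral_def
    using density_on_real_set_integrable[OF h S] h
    by (intro nn_integral_eq_integral) (auto simp: set_integrable_def density_on_real_def)
  finally have "ennreal (measure P (X -` S \<inter> space P)) = ennreal (LINT x:S|lborel. h x)"
    by (simp add: emeasure_eq_measure)
  moreover have "0 \<le> (LINT x:S|lborel. h x)"
    using h unfolding set_lebesgue_integral_def by (intro integral_nonneg_AE) (auto simp: density_on_real_def)
  ultimately show ?thesis by simp
qed

lemma symmetric_decreasing_ge:
  fixes h :: "real \<Rightarrow> real"
  assumes "\<And>x. h (- x) = h x" "antimono_on {0..} h" "\<bar>x\<bar> \<le> y"
  shows "h y \<le> h x"
proof -
  have "h y \<le> h \<bar>x\<bar>" using assms(2,3) by (auto simp: monotone_on_def)
  then show ?thesis using assms(1)[of x] by (simp add: abs_if split: if_splits)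
qed

lemma set_integral_Icc_ge:
  fixes h :: "real \<Rightarrow> real"
  assumes h: "density_on_real h" and "u \<le> v" and le: "\<And>x. u \<le> x \<Longrightarrow> x \<le> v \<Longrightarrow> c \<le> h x"
  shows "c * (v - u) \<le> (LINT x:{u..v}|lborel. h x)"
proof -
  have "(LINT x:{u..v}|lborel. c) = c * (v - u)"
    using assms(2) by (simp add: set_lebesgue_integral_def)
  moreover have "(LINT x:{u..v}|lborel. c) \<le> (LINT x:{u..v}|lborel. h x)"
  proof (rule set_integral_mono)
    show "set_integrable lborel {u..v} (\<lambda>x. c)"
      unfolding set_integrable_def
      by (intro integrable_scaleR_left integrable_real_indicator) (auto simp: emeasure_lborel_Icc_eq)
    show "set_integrable lborel {u..v} h" by (intro density_on_real_set_integrable h) auto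
  qed (use le in auto)
  ultimately show ?thesis by simp
qed

text \<open>The interval is the event that the scaled coefficient is within \<eta> of
  \<open>a\<close>. Its length is at least \<eta> because s \<le> 1, and it lies in [-y, y], where
  symmetry and monotonicity give the lower bound \<open>h y\<close>.\<close>

lemma rescaled_interval_mass_ge:
  fixes h :: "real \<Rightarrow> real"
  assumes h: "density_on_real h" and sym: "\<And>x. h (- x) = h x" and anti: "antimono_on {0..} h"
    and a: "\<bar>a\<bar> \<le> L" and s: "0 < s" "s \<le> 1" and \<eta>: "0 < \<eta>" "\<eta> \<le> 1" and y: "(L + 1) / s \<le> y"
  shows "\<eta> * h y \<le> (LINT x:{(a - \<eta>) / s..(a + \<eta>) / s}|lborel. h x)"
proof -
  have h0: "0 \<le> h y" using h by (simp add: density_on_real_def)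
  have "\<eta> \<le> 2 * \<eta> / s"
    using s \<eta> mult_left_mono[of s 1 \<eta>] by (simp add: field_simps)
  also have "\<dots> = (a + \<eta>) / s - (a - \<eta>) / s"
    by (simp add: diff_divide_distrib add_divide_distrib)
  finally have "\<eta> * h y \<le> ((a + \<eta>) / s - (a - \<eta>) / s) * h y"
    using h0 by (intro mult_right_mono)
  also have "\<dots> = h y * ((a + \<eta>) / s - (a - \<eta>) / s)" by simp
  also have "\<dots> \<le> (LINT x:{(a - \<eta>) / s..(a + \<eta>) / s}|lborel. h x)"
  proof (rule set_integral_Icc_ge[OF h])
    show "(a - \<eta>) / s \<le> (a + \<eta>) / s" using s \<eta> by (simp add: divide_right_mono)
    fix x assume x: "(a - \<eta>) / s \<le> x" "x \<le> (a + \<eta>) / s"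
    have "\<bar>x * s\<bar> \<le> L + 1"
      using x s a \<eta> by (simp add: field_simps abs_le_iff)
    then have "\<bar>x\<bar> \<le> (L + 1) / s" using s by (simp add: field_simps abs_mult)
    then show "h y \<le> h x" using y by (intro symmetric_decreasing_ge[OF sym anti]) auto
  qed
  finally show ?thesis .
qed

text \<open>The exponential form keeps the product of these probabilities over all high levels under control.\<close>
lemma centered_interval_mass_ge:
  fixes h :: "real \<Rightarrow> real"
  assumes h: "density_on_real h" and sym: "\<And>x. h (- x) = h x" and anti: "antimono_on {0..} h"
    and pos: "\<And>x. 0 < h x" and c2: "0 < c2"
    and tail: "\<And>x. x \<ge> 1 \<Longrightarrow> (LINT u:{x..}|lborel. h u) \<le> c2 / x\<^sup>2"
  obtains D where "0 < D" "\<And>t. 1 \<le> t \<Longrightarrow> exp (- (D / t\<^sup>2)) \<le> (LINT x:{-t..t}|lborel. h x)"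
proof -
  let ?I = "\<lambda>S. LINT x:S|lborel. h x"
  have nonneg: "0 \<le> h x" for x using pos[of x] by simp
  have mono: "?I {-1..1} \<le> ?I {-t..t}" if "1 \<le> t" for t
    using that by (intro density_on_real_set_integral_mono h) auto
  have p1: "0 < ?I {-1..1}"
  proof -
    have "h 1 * (1 - (-1)) \<le> ?I {-1..1}"
      by (intro set_integral_Icc_ge h symmetric_decreasing_ge[OF sym anti]) auto
    then show ?thesis using pos[of 1] by simp
  qed
  \<comment> \<open>Reflection makes the two tails equal, so the tail hypothesis is used
    twice.\<close>
  have compl: "1 - 2 * c2 / t\<^sup>2 \<le> ?I {-t..t}" if t: "1 \<le> t" for t
  proof -
    have refl: "?I {..-t} = ?I {t..}"
      using set_integral_reflect[of "{..-t}" h] sym by (simp add: atLeast_def le_minus_iff)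
    have "1 = ?I UNIV"
      using density_on_real_integrable[OF h] by (simp add: set_lebesgue_integral_def)
    also have "UNIV = {..<-t} \<union> ({-t..t} \<union> {t<..})" using t by auto
    also have "?I \<dots> = ?I {..<-t} + ?I ({-t..t} \<union> {t<..})"
      using t by (intro set_integral_Un density_on_real_set_integrable h) auto
    also have "?I ({-t..t} \<union> {t<..}) = ?I {-t..t} + ?I {t<..}"
      using t by (intro set_integral_Un density_on_real_set_integrable h) auto
    also have "?I {..<-t} \<le> ?I {..-t}"
      by (intro density_on_real_set_integral_mono h) auto
    also have "?I {t<..} \<le> ?I {t..}"
      by (intro density_on_real_set_integral_mono h) auto
    finally have "1 \<le> ?I {-t..t} + 2 * ?I {t..}" using refl by simp
    moreover have "2 * c2 / t\<^sup>2 = 2 * (c2 / t\<^sup>2)" by simp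
    ultimately show ?thesis using tail[OF t] by linarith
  qed
  \<comment> \<open>The minimum with 1 makes ln (1 / p) nonnegative. The constant \<open>D\<close>
    serves two regimes: for large \<open>t\<close> it covers twice the mass of both tails, and for
    bounded \<open>t\<close> it makes the exponential fall below the fixed mass of [-1, 1].\<close>
  define p where "p = min (?I {-1..1}) 1"
  define D where "D = 4 * c2 * (1 + ln (1 / p))"
  have p: "0 < p" "p \<le> 1" using p1 by (auto simp: p_def)
  have lnp: "0 \<le> ln (1 / p)" using p by simp
  have D4: "4 * c2 \<le> D" "4 * c2 * ln (1 / p) \<le> D" using c2 lnp by (auto simp: D_def algebra_simps)
  have "exp (- (D / t\<^sup>2)) \<le> ?I {-t..t}" if t: "1 \<le> t" for t
  proof (cases "4 * c2 \<le> t\<^sup>2")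
    case True
    define y where "y = 2 * c2 / t\<^sup>2"
    have t2: "0 < t\<^sup>2" using t by simp
    have y: "0 \<le> y" "y \<le> 1/2" using True c2 t2 by (auto simp: y_def divide_simps)
    \<comment> \<open>For y in [0, 1/2] this gives 1 - y \<ge> exp (- 2 * y), turning the polynomial
      tail bound into exponential form.\<close>
    have "1 \<le> (1 - y) * (1 + 2 * y)"
      using mult_nonneg_nonneg[of y "1 - 2 * y"] y by (simp add: algebra_simps)
    also have "\<dots> \<le> (1 - y) * exp (2 * y)"
      using y by (intro mult_left_mono exp_ge_add_one_self) auto
    finally have "exp (- (2 * y)) \<le> 1 - y"
      by (simp add: exp_minus field_simps)
    moreover have "2 * y \<le> D / t\<^sup>2"
      using D4(1) t2 by (simp add: y_def divide_right_mono)
    then have "exp (- (D / t\<^sup>2)) \<le> exp (- (2 * y))" by simp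
    ultimately show ?thesis using compl[OF t] unfolding y_def[symmetric] by linarith
  next
    case False
    have t2: "0 < t\<^sup>2" using t by simp
    have "ln (1 / p) * t\<^sup>2 \<le> ln (1 / p) * (4 * c2)"
      using False lnp by (intro mult_left_mono) auto
    then have "ln (1 / p) \<le> D / t\<^sup>2"
      using D4(2) t2 by (simp add: field_simps)
    then have "exp (- (D / t\<^sup>2)) \<le> exp (- ln (1 / p))" by simp
    also have "\<dots> = p" using p by (simp add: ln_div)
    also have "\<dots> \<le> ?I {-t..t}" using mono[OF t] by (simp add: p_def)
    finally show ?thesis .
  qed
  moreover have "0 < D" using c2 D4(1) by linarith
  ultimately show ?thesis using that by blast
qed

text \<open>For finitely many levels independence gives a product, in which level \<open>l\<close>
  contributes 2^l factors. Since the total exponent is bounded uniformly in the number of levels,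
  continuity from above along the decreasing events extends the bound to all levels.\<close>

lemma prob_level_sets_ge:
  fixes \<zeta> :: "nat \<Rightarrow> nat \<Rightarrow> 'w \<Rightarrow> real" and b :: "nat \<Rightarrow> real"
  assumes P: "prob_space P"
    and indep: "prob_space.indep_vars P (\<lambda>_. borel) (\<lambda>(l, k). \<zeta> l k) (SIGMA l:UNIV. K l)"
    and S: "\<And>l k. S l k \<in> sets borel"
    and ge: "\<And>l k. k \<in> K l \<Longrightarrow> exp (- b l) \<le> measure P (\<zeta> l k -` S l k \<inter> space P)"
    and bound: "\<And>N. (\<Sum>l<N. 2 ^ l * b l) \<le> c"
  shows "{\<omega> \<in> space P. \<forall>l. \<forall>k\<in>K l. \<zeta> l k \<omega> \<in> S l k} \<in> sets P" (is "?A \<in> _")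
    and "exp (- c) \<le> measure P {\<omega> \<in> space P. \<forall>l. \<forall>k\<in>K l. \<zeta> l k \<omega> \<in> S l k}"
proof -
  interpret prob_space P by (rule P)
  have rv: "\<zeta> l k \<in> borel_measurable P" if "k \<in> K l" for l k
    using indep that unfolding indep_vars_def by force
  \<comment> \<open>Taking \<open>Suc N\<close> levels keeps the index set nonempty for every
    \<open>N\<close>, as the product formula for independent variables requires.\<close>
  define I where "I N = (SIGMA l:{..<Suc N}. K l)" for N
  define A where "A N = (\<Inter>i\<in>I N. (case i of (l, k) \<Rightarrow> \<zeta> l k) -` (case i of (l, k) \<Rightarrow> S l k) \<inter> space P)" for N
  have I_fin: "finite (I N)" for N unfolding I_def K_def by auto
  have "(0, 0) \<in> I N" for N by (auto simp: I_def K_def)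
  then have I_ne: "I N \<noteq> {}" for N by blast
  have A_eq: "A N = {\<omega> \<in> space P. \<forall>l<Suc N. \<forall>k\<in>K l. \<zeta> l k \<omega> \<in> S l k}" for N
    using I_ne[of N] by (auto simp: A_def I_def)
  have A_meas: "A N \<in> sets P" for N
    unfolding A_def using I_fin I_ne
    by (intro sets.finite_INT) (auto simp: I_def intro!: measurable_sets[OF rv] S)
  have eq: "?A = (\<Inter>N. A N)"
  proof (intro equalityI subsetI)
    fix \<omega> assume \<omega>: "\<omega> \<in> (\<Inter>N. A N)"
    have "\<omega> \<in> A l" for l using \<omega> by blast
    then show "\<omega> \<in> ?A" unfolding A_eq by (simp, meson lessI)
  next
    fix \<omega> assume "\<omega> \<in> ?A"
    then show "\<omega> \<in> (\<Inter>N. A N)" unfolding A_eq by simp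
  qed
  have "A N \<in> sets P" for N by (rule A_meas)
  then show "?A \<in> sets P" unfolding eq by auto
  have "exp (- c) \<le> prob (A N)" for N
  proof -
    have "exp (- c) \<le> exp (- (\<Sum>l<Suc N. 2 ^ l * b l))" using bound[of "Suc N"] by simp
    also have "\<dots> = (\<Prod>l<Suc N. \<Prod>k\<in>K l. exp (- b l))"
      by (simp add: exp_sum[symmetric] sum_negf K_def exp_of_nat_mult[symmetric] del: sum.lessThan_Suc prod.lessThan_Suc)
    also have "\<dots> = (\<Prod>(l, k)\<in>I N. exp (- b l))"
      unfolding I_def by (rule prod.Sigma) (auto simp: K_def)
    also have "\<dots> \<le> (\<Prod>i\<in>I N. prob ((case i of (l, k) \<Rightarrow> \<zeta> l k) -` (case i of (l, k) \<Rightarrow> S l k) \<inter> space P))"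
      by (intro prod_mono) (auto simp: I_def ge)
    also have "\<dots> = prob (A N)"
      unfolding A_def
      by (rule indep_varsD[OF indep I_ne I_fin, symmetric]) (auto simp: I_def S)
    finally show ?thesis .
  qed
  moreover have "(\<lambda>N. prob (A N)) \<longlonglongrightarrow> prob (\<Inter>N. A N)"
  proof (intro finite_Lim_measure_decseq)
    show "decseq A" unfolding decseq_def A_eq by force
  qed (simp add: A_meas image_subset_iff)
  ultimately show "exp (- c) \<le> prob ?A"
    unfolding eq by (intro LIMSEQ_le_const) auto
qed

section \<open>Deterministic bounds on coefficient perturbations\<close>

text \<open>The first nonzero term, at level J + 1, is \<theta> rather than 1; hence the numerator
  \<theta>.\<close>

lemma shifted_geometric_sums:
  fixes \<theta> :: real
  assumes "0 < \<theta>" "\<theta> < 1"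
  shows "(\<lambda>l. if J < l then \<theta> ^ (l - J) else 0) sums (\<theta> / (1 - \<theta>))"
proof -
  have "(\<lambda>i. \<theta> * \<theta> ^ i) sums (\<theta> * (1 / (1 - \<theta>)))"
    using assms by (intro sums_mult geometric_sums) auto
  then have "(\<lambda>i. if J < i + Suc J then \<theta> ^ (i + Suc J - J) else 0) sums (\<theta> / (1 - \<theta>))"
    by (simp add: Suc_diff_le)
  then show ?thesis
    by (subst (asm) sums_iff_shift) simp
qed

lemma wavelet_level_sum_le:
  assumes C: "\<And>x. x \<in> {0..1} \<Longrightarrow> (\<Sum>k\<in>K l. \<bar>\<psi> l k x\<bar>) \<le> C * 2 powr (real l / 2)"
    and d: "\<And>k. k \<in> K l \<Longrightarrow> \<bar>d k\<bar> \<le> e" and x: "x \<in> {0..1}"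
  shows "\<bar>\<Sum>k\<in>K l. d k * \<psi> l k x\<bar> \<le> C * (e * 2 powr (real l / 2))"
proof -
  have "0 \<in> K l" by (simp add: K_def)
  then have e: "0 \<le> e" using d[of 0] by linarith
  have "\<bar>\<Sum>k\<in>K l. d k * \<psi> l k x\<bar> \<le> (\<Sum>k\<in>K l. e * \<bar>\<psi> l k x\<bar>)"
    using d by (intro order.trans[OF sum_abs] sum_mono) (auto simp: abs_mult intro!: mult_right_mono)
  also have "\<dots> \<le> e * (C * 2 powr (real l / 2))"
    unfolding sum_distrib_left[symmetric] by (intro mult_left_mono C x e)
  finally show ?thesis by (simp add: ac_simps)
qed

text \<open>The localisation factor 2 powr (l / 2) cancels the 1/2 in the Hoelder exponent, leaving
  geometric decay of ratio 2 powr (- \<beta>).\<close>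

lemma wavelet_level_sum_holder_le:
  assumes C: "\<And>x. x \<in> {0..1} \<Longrightarrow> (\<Sum>k\<in>K l. \<bar>\<psi> l k x\<bar>) \<le> C * 2 powr (real l / 2)"
    and a: "\<And>k. k \<in> K l \<Longrightarrow> \<bar>a k\<bar> \<le> 2 powr (- (real l * (1/2 + \<beta>))) * L" and x: "x \<in> {0..1}"
  shows "\<bar>\<Sum>k\<in>K l. a k * \<psi> l k x\<bar> \<le> C * L * (2 powr (- \<beta>)) ^ l"
proof -
  have "\<bar>\<Sum>k\<in>K l. a k * \<psi> l k x\<bar> \<le> C * (2 powr (- (real l * (1/2 + \<beta>))) * L * 2 powr (real l / 2))"
    by (rule wavelet_level_sum_le[OF _ a x]) (rule C)
  also have "2 powr (- (real l * (1/2 + \<beta>))) * L * 2 powr (real l / 2) = L * (2 powr (- \<beta>)) ^ l"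
    by (simp add: powr_power algebra_simps flip: powr_add)
  finally show ?thesis by simp
qed

text \<open>Levels up to \<open>J\<close> are pinned so precisely that they sum to a multiple of 2
  powr (- J * \<beta>). Above \<open>J\<close>, the growth allowed to \<open>d\<close> is slower
  than the decay of the scales, leaving a factor 2 powr (- J * \<alpha>) and ratio \<theta>1; the
  target contributes 2 powr (- J * \<beta>) and ratio \<theta>2. Finally \<beta> \<le> \<alpha> is
  used.\<close>

lemma wavelet_series_coeff_dist_le:
  fixes a d :: "nat \<Rightarrow> nat \<Rightarrow> real"
  assumes C: "0 \<le> C" "\<And>l x. x \<in> {0..1} \<Longrightarrow> (\<Sum>k\<in>K l. \<bar>\<psi> l k x\<bar>) \<le> C * 2 powr (real l / 2)"
    and \<beta>: "0 < \<beta>" and \<alpha>: "1/2 < \<alpha>" "\<beta> \<le> \<alpha>" and L: "0 < L" and S: "0 < S"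
    and a: "\<And>l k. k \<in> K l \<Longrightarrow> \<bar>a l k\<bar> \<le> 2 powr (- (real l * (1/2 + \<beta>))) * L"
    and low: "\<And>l k. l \<le> J \<Longrightarrow> k \<in> K l \<Longrightarrow> \<bar>d l k - a l k\<bar> \<le> 2 powr (- (real J * (\<beta> + 2)))"
    and high: "\<And>l k. J < l \<Longrightarrow> k \<in> K l \<Longrightarrow>
      \<bar>d l k\<bar> \<le> S * 2 powr (- (real l * (1/2 + \<alpha>))) * 2 powr (real (l - J) * (1/4 + \<alpha>/2))"
    and \<theta>: "\<theta>1 = 2 powr (- (\<alpha>/2 - 1/4))" "\<theta>2 = 2 powr (- \<beta>)"
    and x: "x \<in> {0..1}"
  shows "\<bar>wavelet_series \<psi> d x - wavelet_series \<psi> a x\<bar>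
    \<le> C * (2 + S * (\<theta>1 / (1 - \<theta>1)) + L * (\<theta>2 / (1 - \<theta>2))) * 2 powr (- (real J * \<beta>))"
proof -
  let ?A = "2 powr (- (real J * \<beta>)) :: real"
  have \<theta>1: "0 < \<theta>1" "\<theta>1 < 1" and \<theta>2: "0 < \<theta>2" "\<theta>2 < 1"
    using \<alpha> \<beta> by (auto simp: \<theta> powr_less_one)
  define m where "m l = C * ?A * ((1/2) ^ l + S * (if J < l then \<theta>1 ^ (l - J) else 0)
      + L * (if J < l then \<theta>2 ^ (l - J) else 0))" for l
  have m_sums: "m sums (C * ?A * (2 + S * (\<theta>1 / (1 - \<theta>1)) + L * (\<theta>2 / (1 - \<theta>2))))"
    unfolding m_def using geometric_sums[of "1/2 :: real"]
    by (intro sums_mult sums_add shifted_geometric_sums \<theta>1 \<theta>2) simp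
  have a_le: "\<bar>\<Sum>k\<in>K l. a l k * \<psi> l k x\<bar> \<le> C * L * \<theta>2 ^ l" for l
    unfolding \<theta> by (rule wavelet_level_sum_holder_le[OF _ a x]) (rule C(2))
  have "summable (\<lambda>l. C * L * \<theta>2 ^ l)"
    using \<theta>2 by (intro summable_mult summable_geometric) auto
  then have a_sum: "summable (\<lambda>l. \<Sum>k\<in>K l. a l k * \<psi> l k x)"
    by (rule summable_comparison_test'[where N = 0]) (use a_le in auto)
  have b_le: "\<bar>\<Sum>k\<in>K l. (d l k - a l k) * \<psi> l k x\<bar> \<le> m l" for l
  proof (cases "l \<le> J")
    case True
    have "\<bar>\<Sum>k\<in>K l. (d l k - a l k) * \<psi> l k x\<bar> \<le> C * (2 powr (- (real J * (\<beta> + 2))) * 2 powr (real l / 2))"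
      by (rule wavelet_level_sum_le[OF C(2) low[OF True] x])
    also have "\<dots> \<le> C * (?A * (1/2) ^ l)"
    proof (rule mult_left_mono[OF _ C(1)])
      have "?A * (1/2) ^ l = 2 powr (- (real J * \<beta>) - real l)"
        by (simp add: powr_diff powr_realpow power_one_over)
      moreover have "2 powr (- (real J * (\<beta> + 2))) * 2 powr (real l / 2)
          = 2 powr (- (real J * (\<beta> + 2)) + real l / 2)"
        by (rule powr_add[symmetric])
      \<comment> \<open>This amounts to 3/2 * l \<le> 2 * J: the extra 2 in the precision exponent
        pays for the localisation factor and for a summable 2 powr (- l).\<close>
      moreover have "- (real J * (\<beta> + 2)) + real l / 2 \<le> - (real J * \<beta>) - real l"
        using True by (simp add: algebra_simps)
      ultimately show "2 powr (- (real J * (\<beta> + 2))) * 2 powr (real l / 2) \<le> ?A * (1/2) ^ l"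
        by simp
    qed
    finally show ?thesis using True by (simp add: m_def ac_simps)
  next
    case False
    then have l: "J < l" by simp
    define j where "j = l - J"
    have l_eq: "real l = real J + real j" using l by (simp add: j_def)
    let ?h = "S * 2 powr (- (real l * (1/2 + \<alpha>))) * 2 powr (real (l - J) * (1/4 + \<alpha>/2))"
    have d: "\<bar>d l k - a l k\<bar> \<le> ?h + 2 powr (- (real l * (1/2 + \<beta>))) * L" if "k \<in> K l" for k
      using high[OF l that] a[OF that] by linarith
    have "\<bar>\<Sum>k\<in>K l. (d l k - a l k) * \<psi> l k x\<bar>
        \<le> C * ((?h + 2 powr (- (real l * (1/2 + \<beta>))) * L) * 2 powr (real l / 2))"
      by (rule wavelet_level_sum_le[OF _ d x]) (rule C(2))
    also have "(?h + 2 powr (- (real l * (1/2 + \<beta>))) * L) * 2 powr (real l / 2)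
        = S * 2 powr (- (real J * \<alpha>)) * \<theta>1 ^ j + L * ?A * \<theta>2 ^ j"
    proof -
      have "2 powr (- (real l * (1/2 + \<alpha>))) * 2 powr (real (l - J) * (1/4 + \<alpha>/2)) * 2 powr (real l / 2)
          = 2 powr (- (real J * \<alpha>)) * \<theta>1 ^ j"
        by (simp add: \<theta> powr_power l_eq algebra_simps flip: powr_add j_def)
      moreover have "2 powr (- (real l * (1/2 + \<beta>))) * 2 powr (real l / 2) = ?A * \<theta>2 ^ j"
        by (simp add: \<theta> powr_power l_eq algebra_simps flip: powr_add)
      ultimately show ?thesis
        by (simp add: distrib_right mult.assoc)
    qed
    also have "C * \<dots> \<le> C * (?A * ((1/2) ^ l + S * \<theta>1 ^ j + L * \<theta>2 ^ j))"
    proof (rule mult_left_mono[OF _ C(1)])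
      have "S * 2 powr (- (real J * \<alpha>)) * \<theta>1 ^ j \<le> S * ?A * \<theta>1 ^ j"
        using S \<alpha> \<theta>1 by (intro mult_right_mono mult_left_mono) (auto intro: mult_left_mono)
      then show "S * 2 powr (- (real J * \<alpha>)) * \<theta>1 ^ j + L * ?A * \<theta>2 ^ j
          \<le> ?A * ((1/2) ^ l + S * \<theta>1 ^ j + L * \<theta>2 ^ j)"
        by (simp add: algebra_simps add_increasing2)
    qed
    finally show ?thesis using l by (simp add: m_def j_def mult.assoc)
  qed
  have b_sum: "summable (\<lambda>l. \<Sum>k\<in>K l. (d l k - a l k) * \<psi> l k x)"
    by (rule summable_comparison_test'[OF sums_summable[OF m_sums], of 0]) (use b_le in auto)
  have "(\<Sum>l. \<Sum>k\<in>K l. d l k * \<psi> l k x)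
      = (\<Sum>l. (\<Sum>k\<in>K l. (d l k - a l k) * \<psi> l k x) + (\<Sum>k\<in>K l. a l k * \<psi> l k x))"
    by (simp flip: sum.distrib add: left_diff_distrib)
  \<comment> \<open>An infinite sum splits only when both parts converge, which is why the
    difference and the series of \<open>a\<close> were majorised separately.\<close>
  also have "\<dots> = (\<Sum>l. \<Sum>k\<in>K l. (d l k - a l k) * \<psi> l k x) + (\<Sum>l. \<Sum>k\<in>K l. a l k * \<psi> l k x)"
    by (rule suminf_add[OF b_sum a_sum, symmetric])
  finally have "\<bar>wavelet_series \<psi> d x - wavelet_series \<psi> a x\<bar> = \<bar>\<Sum>l. \<Sum>k\<in>K l. (d l k - a l k) * \<psi> l k x\<bar>"
    by (simp add: wavelet_series_def)
  also have "\<dots> \<le> (\<Sum>l. m l)"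
    using suminf_diff_partial_sum_le[OF sums_summable[OF m_sums] b_le, of 0] by simp
  also have "\<dots> = C * ?A * (2 + S * (\<theta>1 / (1 - \<theta>1)) + L * (\<theta>2 / (1 - \<theta>2)))"
    using m_sums by (rule sums_unique[symmetric])
  finally show ?thesis by (simp add: ac_simps)
qed

section \<open>Cost of pinning and of the remaining levels\<close>

text \<open>At the given argument ln (1 + y) is of order J^p, so the hypothesis on \<open>h\<close>
  costs an exponent of order J powr (p * (1 + \<kappa>)). The width of the interval costs only order
  \<open>J\<close>, which is absorbed because J \<ge> 1 and p * (1 + \<kappa>) \<ge> 1.\<close>

lemma low_level_mass_ge:
  fixes h :: "real \<Rightarrow> real" and J p :: nat
  assumes pos: "\<And>x. 0 < h x" and c1: "0 < c1" and \<kappa>: "0 \<le> \<kappa>"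
    and h_log: "\<And>x. x \<ge> 0 \<Longrightarrow> ln (1 / h x) \<le> c1 * (1 + ln (1 + x) powr (1 + \<kappa>))"
    and L: "0 < L" and q: "0 \<le> q" and \<beta>: "0 < \<beta>" and J: "1 \<le> J" and p: "1 \<le> p"
  shows "exp (- ((\<beta> + 2 + c1 + c1 * (ln (L + 2) + q) powr (1 + \<kappa>)) * real J powr (real p * (1 + \<kappa>))))
    \<le> 2 powr (- (real J * (\<beta> + 2))) * h ((L + 1) * 2 powr (q * real J ^ p))"
proof -
  define H where "H = ln (L + 2) + q"
  define w where "w = real p * (1 + \<kappa>)"
  let ?Q = "q * real J ^ p"
  let ?y = "(L + 1) * 2 powr ?Q"
  have J1: "1 \<le> real J" using J by simp
  have Jp: "1 \<le> real J ^ p" using J1 by (rule one_le_power)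
  have w1: "1 \<le> w" using p \<kappa> mult_mono[of 1 "real p" 1 "1 + \<kappa>"] by (simp add: w_def)
  have Jw: "real J \<le> real J powr w" using powr_mono[of 1 w "real J"] w1 J1 by simp
  have lnL: "0 < ln (L + 2)" using L by simp
  then have H: "0 \<le> H" using q by (simp add: H_def)
  have y: "0 \<le> ?y" using L by simp
  have "1 + ?y \<le> (L + 2) * 2 powr ?Q"
    using q ge_one_powr_ge_zero[of 2 ?Q] by (simp add: algebra_simps)
  then have "ln (1 + ?y) \<le> ln ((L + 2) * 2 powr ?Q)" using y by (subst ln_le_cancel_iff) auto
  also have "\<dots> = ln (L + 2) + ?Q * ln 2" using L by (simp add: ln_mult ln_powr)
  also have "\<dots> \<le> ln (L + 2) * real J ^ p + ?Q"
  proof (rule add_mono)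
    show "ln (L + 2) \<le> ln (L + 2) * real J ^ p" using lnL Jp by simp
    show "?Q * ln 2 \<le> ?Q" using q ln2_le_25_over_36 by (intro mult_left_le) auto
  qed
  finally have "ln (1 + ?y) \<le> H * real J ^ p" by (simp add: H_def algebra_simps)
  then have "ln (1 + ?y) powr (1 + \<kappa>) \<le> (H * real J ^ p) powr (1 + \<kappa>)"
    using \<kappa> y by (intro powr_mono2) auto
  also have "\<dots> = H powr (1 + \<kappa>) * real J powr w"
    using J1 H by (simp add: powr_mult w_def powr_powr flip: powr_realpow)
  finally have "ln (1 / h ?y) \<le> c1 * (1 + H powr (1 + \<kappa>) * real J powr w)"
    using h_log[OF y] c1 by (smt (verit) mult_left_mono)
  also have "\<dots> \<le> (c1 + c1 * H powr (1 + \<kappa>)) * real J powr w"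
    using c1 Jw J1 by (simp add: algebra_simps)
  finally have "- ((c1 + c1 * H powr (1 + \<kappa>)) * real J powr w) \<le> ln (h ?y)"
    using pos[of ?y] by (simp add: ln_div)
  moreover have "(real J * (\<beta> + 2)) * ln 2 \<le> (\<beta> + 2) * real J powr w"
  proof -
    have "(real J * (\<beta> + 2)) * ln 2 \<le> real J * (\<beta> + 2)"
      using \<beta> ln2_le_25_over_36 by (intro mult_left_le) auto
    also have "\<dots> \<le> real J powr w * (\<beta> + 2)" using Jw \<beta> by (intro mult_right_mono) auto
    finally show ?thesis by (simp add: mult.commute)
  qed
  ultimately have "- ((\<beta> + 2 + c1 + c1 * H powr (1 + \<kappa>)) * real J powr w)
      \<le> - (real J * (\<beta> + 2)) * ln 2 + ln (h ?y)"
    by (simp add: algebra_simps)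
  then have "exp (- ((\<beta> + 2 + c1 + c1 * H powr (1 + \<kappa>)) * real J powr w))
      \<le> exp (- (real J * (\<beta> + 2)) * ln 2 + ln (h ?y))"
    by simp
  also have "\<dots> = exp (- (real J * (\<beta> + 2)) * ln 2) * h ?y"
    using pos[of ?y] by (simp only: exp_add exp_ln)
  also have "exp (- (real J * (\<beta> + 2)) * ln 2) = 2 powr (- (real J * (\<beta> + 2)))"
    by (simp add: powr_def)
  finally show ?thesis unfolding H_def w_def .
qed

text \<open>Fewer than 2^(J+1) coefficients are pinned, each at the cost just bounded. The free
  levels cost in total a multiple of 2^J, because their thresholds grow fast enough. Both constants
  are independent of \<open>J\<close>, which is what allows \<open>J\<close> to vary with the sample
  size.\<close>

lemma prior_small_ball:
  fixes \<psi> :: "nat \<Rightarrow> nat \<Rightarrow> real \<Rightarrow> real" and \<zeta> :: "nat \<Rightarrow> nat \<Rightarrow> 'w \<Rightarrow> real" and p :: nat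
  assumes basis: "wavelet_basis \<psi>"
    and h: "density_on_real h" and sym: "\<And>x. h (- x) = h x" and pos: "\<And>x. 0 < h x"
    and anti: "antimono_on {0..} h"
    and c1: "0 < c1" and \<kappa>: "0 \<le> \<kappa>"
    and h_log: "\<And>x. x \<ge> 0 \<Longrightarrow> ln (1 / h x) \<le> c1 * (1 + ln (1 + x) powr (1 + \<kappa>))"
    and c2: "0 < c2" and tail: "\<And>x. x \<ge> 1 \<Longrightarrow> (LINT u:{x..}|lborel. h u) \<le> c2 / x\<^sup>2"
    and P: "prob_space P"
    and law: "\<And>l k. k \<in> K l \<Longrightarrow> distributed P lborel (\<zeta> l k) (\<lambda>x. ennreal (h x))"
    and indep: "prob_space.indep_vars P (\<lambda>_. borel) (\<lambda>(l, k). \<zeta> l k) (SIGMA l:UNIV. K l)"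
    and \<beta>: "0 < \<beta>" and L: "0 < L" and \<alpha>: "1/2 < \<alpha>" "\<beta> \<le> \<alpha>" and S: "0 < S"
    and s: "\<And>l. 0 < s l" "\<And>l. s l \<le> 1" "\<And>l. s l \<le> S * 2 powr (- (real l * (1/2 + \<alpha>)))"
    and q: "0 \<le> q" and p: "1 \<le> p"
    and s_lower: "\<And>l J. l \<le> J \<Longrightarrow> 1 / s l \<le> 2 powr (q * real J ^ p)"
    and a: "\<And>l k. k \<in> K l \<Longrightarrow> \<bar>a l k\<bar> \<le> 2 powr (- (real l * (1/2 + \<beta>))) * L"
  shows "\<exists>c D. 0 < c \<and> 0 \<le> D \<and> (\<forall>J\<ge>1. \<exists>A\<in>sets P.
       exp (- (c * (2 ^ J * real J powr (real p * (1 + \<kappa>))))) \<le> measure P A \<and>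
       (\<forall>\<omega>\<in>A. \<forall>x\<in>{0..1}. \<bar>wavelet_series \<psi> (\<lambda>l k. s l * \<zeta> l k \<omega>) x - wavelet_series \<psi> a x\<bar>
          \<le> D * 2 powr (- (real J * \<beta>))))"
proof -
  obtain C where C: "\<And>l x. x \<in> {0..1} \<Longrightarrow> (\<Sum>k\<in>K l. \<bar>\<psi> l k x\<bar>) \<le> C * 2 powr (real l / 2)"
    using basis unfolding wavelet_basis_def by blast
  have C0: "0 \<le> C"
    using order_trans[OF sum_nonneg C[of 0 0]] by simp
  obtain D0 where D0: "0 < D0"
    and center: "\<And>t. 1 \<le> t \<Longrightarrow> exp (- (D0 / t\<^sup>2)) \<le> (LINT x:{-t..t}|lborel. h x)"
    using centered_interval_mass_ge[OF h sym anti pos c2 tail] by blast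
  define w where "w = real p * (1 + \<kappa>)"
  define b0 where "b0 = \<beta> + 2 + c1 + c1 * (ln (L + 2) + q) powr (1 + \<kappa>)"
  define \<theta>1 \<theta>2 \<theta>3 :: real where "\<theta>1 = 2 powr (- (\<alpha>/2 - 1/4))" and "\<theta>2 = 2 powr (- \<beta>)"
    and "\<theta>3 = 2 powr (- (\<alpha> - 1/2))"
  have \<theta>: "0 < \<theta>1" "\<theta>1 < 1" "0 < \<theta>2" "\<theta>2 < 1" "0 < \<theta>3" "\<theta>3 < 1"
    using \<alpha> \<beta> by (auto simp: \<theta>1_def \<theta>2_def \<theta>3_def powr_less_one)
  \<comment> \<open>The term 2 * b0 comes from the sum of 2^l over levels up to \<open>J\<close>,
    the other from the geometric sum of the costs above \<open>J\<close>. The constant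
    \<open>D\<close> is the one of the deterministic bound.\<close>
  define c where "c = 2 * b0 + D0 * (\<theta>3 / (1 - \<theta>3))"
  define D where "D = C * (2 + S * (\<theta>1 / (1 - \<theta>1)) + L * (\<theta>2 / (1 - \<theta>2)))"
  have b0: "0 < b0" using \<beta> c1 by (auto simp: b0_def intro!: add_pos_nonneg)
  have c: "0 < c" using b0 D0 \<theta> by (auto simp: c_def intro!: add_pos_pos)
  have D: "0 \<le> D" using C0 S L \<theta> by (auto simp: D_def intro!: mult_nonneg_nonneg add_nonneg_nonneg)
  have aL: "\<bar>a l k\<bar> \<le> L" if "k \<in> K l" for l k
  proof -
    have "2 powr (- (real l * (1/2 + \<beta>))) \<le> (1::real)"
      using \<beta> powr_mono[of "- (real l * (1/2 + \<beta>))" 0 2] by simp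
    then have "2 powr (- (real l * (1/2 + \<beta>))) * L \<le> 1 * L" using L by (intro mult_right_mono) auto
    then show ?thesis using a[OF that] by linarith
  qed
  have "\<exists>A\<in>sets P. exp (- (c * (2 ^ J * real J powr w))) \<le> measure P A \<and>
       (\<forall>\<omega>\<in>A. \<forall>x\<in>{0..1}. \<bar>wavelet_series \<psi> (\<lambda>l k. s l * \<zeta> l k \<omega>) x - wavelet_series \<psi> a x\<bar>
          \<le> D * 2 powr (- (real J * \<beta>)))" if J: "1 \<le> J" for J
  proof -
    define \<eta> :: real where "\<eta> = 2 powr (- (real J * (\<beta> + 2)))"
    have \<eta>: "0 < \<eta>" "\<eta> \<le> 1" using \<beta> powr_mono[of "- (real J * (\<beta> + 2))" 0 2] by (auto simp: \<eta>_def)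
    \<comment> \<open>The growth exponent is the midpoint of 1/2 and \<alpha>. Exceeding 1/2 makes
      2^l / t^2 summable with ratio \<theta>3; staying below \<alpha> makes the sup-norm
      contributions summable with ratio \<theta>1.\<close>
    define t :: "nat \<Rightarrow> real" where "t l = 2 powr (real (l - J) * (1/4 + \<alpha>/2))" for l
    have t: "1 \<le> t l" for l using \<alpha> by (auto simp: t_def intro!: ge_one_powr_ge_zero)
    define W where "W l k = (if l \<le> J then {(a l k - \<eta>) / s l..(a l k + \<eta>) / s l} else {- t l..t l})" for l k
    define b where "b l = (if l \<le> J then b0 * real J powr w else D0 / (t l)\<^sup>2)" for l
    let ?A = "{\<omega> \<in> space P. \<forall>l. \<forall>k\<in>K l. \<zeta> l k \<omega> \<in> W l k}"
    have W: "W l k \<in> sets borel" for l k by (simp add: W_def)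
    have ge: "exp (- b l) \<le> measure P (\<zeta> l k -` W l k \<inter> space P)" if k: "k \<in> K l" for l k
      unfolding prob_distributed_eq_set_integral[OF P h law[OF k] W]
    proof (cases "l \<le> J")
      case True
      have "exp (- (b0 * real J powr w)) \<le> \<eta> * h ((L + 1) * 2 powr (q * real J ^ p))"
        unfolding b0_def \<eta>_def w_def using low_level_mass_ge[OF pos c1 \<kappa> h_log L q \<beta> J p] .
      also have "\<dots> \<le> (LINT x:{(a l k - \<eta>) / s l..(a l k + \<eta>) / s l}|lborel. h x)"
      proof (rule rescaled_interval_mass_ge[OF h sym anti aL[OF k] s(1,2) \<eta>])
        have "(L + 1) * (1 / s l) \<le> (L + 1) * 2 powr (q * real J ^ p)"
          using L s_lower[OF True] by (intro mult_left_mono) auto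
        then show "(L + 1) / s l \<le> (L + 1) * 2 powr (q * real J ^ p)" by simp
      qed
      finally show "exp (- b l) \<le> (LINT x:W l k|lborel. h x)" using True by (simp add: b_def W_def)
    next
      case False
      then show "exp (- b l) \<le> (LINT x:W l k|lborel. h x)" using center[OF t] by (simp add: b_def W_def)
    qed
    have bound: "(\<Sum>l<N. 2 ^ l * b l) \<le> c * (2 ^ J * real J powr w)" for N
    proof -
      let ?f = "\<lambda>l. if l \<in> {..J} then 2 ^ l * (b0 * real J powr w) else 0"
      let ?g = "\<lambda>l. 2 ^ J * D0 * (if J < l then \<theta>3 ^ (l - J) else 0)"
      have split: "2 ^ l * b l = ?f l + ?g l" for l
      proof (cases "l \<le> J")
        case False
        then obtain j where j: "l = J + j" by (metis le_iff_add nat_le_linear)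
        have "2 ^ j / (t l)\<^sup>2 = 2 powr real j / 2 powr (2 * (real j * (1/4 + \<alpha>/2)))"
          by (simp add: t_def j powr_realpow power2_eq_square flip: powr_add)
        also have "\<dots> = \<theta>3 ^ j"
          by (simp add: \<theta>3_def powr_power algebra_simps flip: powr_diff)
        finally have "2 ^ j / (t l)\<^sup>2 = \<theta>3 ^ j" .
        then have "2 ^ l * (D0 / (t l)\<^sup>2) = 2 ^ J * D0 * \<theta>3 ^ j"
          by (simp add: j power_add flip: \<open>2 ^ j / (t l)\<^sup>2 = \<theta>3 ^ j\<close>)
        then show ?thesis using False by (simp add: b_def j)
      qed (simp add: b_def)
      \<comment> \<open>Comparison with the whole finitely supported series avoids distinguishing
        whether \<open>N\<close> or \<open>J\<close> is larger.\<close>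
      have "(\<Sum>l<N. ?f l) \<le> (\<Sum>l\<in>{..J}. 2 ^ l * (b0 * real J powr w))"
        using b0 sum_le_suminf[of ?f "{..<N}"] sums_If_finite_set[of "{..J}" "\<lambda>l. 2 ^ l * (b0 * real J powr w)", THEN sums_unique]
        by simp
      also have "\<dots> = (2 ^ Suc J - 1) * (b0 * real J powr w)"
        using sum_gp0[of "2::real" J] by (simp flip: sum_distrib_right)
      also have "\<dots> \<le> 2 ^ Suc J * (b0 * real J powr w)"
        using b0 by (intro mult_right_mono) auto
      finally have f: "(\<Sum>l<N. ?f l) \<le> 2 * b0 * (2 ^ J * real J powr w)" by (simp add: ac_simps)
      have g_sums: "?g sums (2 ^ J * D0 * (\<theta>3 / (1 - \<theta>3)))"
        by (intro sums_mult shifted_geometric_sums \<theta>)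
      then have "(\<Sum>l<N. ?g l) \<le> 2 ^ J * D0 * (\<theta>3 / (1 - \<theta>3))"
        using D0 \<theta> sum_le_suminf[OF sums_summable[OF g_sums], of "{..<N}"] sums_unique[OF g_sums] by simp
      also have "\<dots> \<le> 2 ^ J * D0 * (\<theta>3 / (1 - \<theta>3)) * real J powr w"
      proof -
        have "1 \<le> real J powr w" using J \<kappa> by (intro ge_one_powr_ge_zero) (auto simp: w_def)
        moreover have "0 \<le> 2 ^ J * D0 * (\<theta>3 / (1 - \<theta>3))" using D0 \<theta> by simp
        ultimately show ?thesis by (metis mult.right_neutral mult_left_mono)
      qed
      finally have "(\<Sum>l<N. ?g l) \<le> D0 * (\<theta>3 / (1 - \<theta>3)) * (2 ^ J * real J powr w)" by (simp add: ac_simps)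
      then show ?thesis using f unfolding split sum.distrib c_def distrib_right by linarith
    qed
    have near: "\<bar>wavelet_series \<psi> (\<lambda>l k. s l * \<zeta> l k \<omega>) x - wavelet_series \<psi> a x\<bar> \<le> D * 2 powr (- (real J * \<beta>))"
      if \<omega>: "\<omega> \<in> ?A" and x: "x \<in> {0..1}" for \<omega> x
      unfolding D_def
    proof (rule wavelet_series_coeff_dist_le[OF C0 C \<beta> \<alpha> L S a _ _ \<theta>1_def \<theta>2_def x])
      fix l k assume l: "l \<le> J" and k: "k \<in> K l"
      have "\<zeta> l k \<omega> \<in> W l k" using \<omega> k by blast
      then have "\<zeta> l k \<omega> \<in> {(a l k - \<eta>) / s l..(a l k + \<eta>) / s l}" using l by (simp add: W_def)
      then show "\<bar>s l * \<zeta> l k \<omega> - a l k\<bar> \<le> 2 powr (- (real J * (\<beta> + 2)))"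
        unfolding \<eta>_def[symmetric] using s(1)[of l]
        by (auto simp: pos_divide_le_eq pos_le_divide_eq abs_le_iff mult.commute)
    next
      fix l k assume l: "J < l" and k: "k \<in> K l"
      have "\<zeta> l k \<omega> \<in> W l k" using \<omega> k by blast
      then have "\<bar>\<zeta> l k \<omega>\<bar> \<le> t l" using l by (simp add: W_def abs_le_iff)
      then have "s l * \<bar>\<zeta> l k \<omega>\<bar> \<le> S * 2 powr (- (real l * (1/2 + \<alpha>))) * t l"
        using s(1,3)[of l] by (intro mult_mono) auto
      then show "\<bar>s l * \<zeta> l k \<omega>\<bar> \<le> S * 2 powr (- (real l * (1/2 + \<alpha>))) * 2 powr (real (l - J) * (1/4 + \<alpha>/2))"
        using s(1)[of l] by (simp add: abs_mult t_def)
    qed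
    show ?thesis
      using near by (intro bexI[of _ ?A] conjI ballI prob_level_sets_ge[OF P indep W ge bound])
  qed
  then show ?thesis using c D unfolding w_def by (intro exI[of _ c] exI[of _ D]) simp
qed

section \<open>Contraction rate\<close>

context
  fixes \<beta> w :: real and \<delta> :: "nat \<Rightarrow> real"
  assumes \<beta>: "0 < \<beta>" and w: "0 < w"
    and \<delta>: "\<And>n. \<delta> n = (real n / ln (real n) powr w) powr (- (\<beta> / (2 * \<beta> + 1)))"
begin

lemma n_over_log_powr_at_top: "filterlim (\<lambda>n. real n / ln (real n) powr w) at_top sequentially"
  using w by real_asymp

lemma rate_tendsto_0: "\<delta> \<longlonglongrightarrow> 0"
proof -
  have "((\<lambda>x::real. x powr (- (\<beta> / (2 * \<beta> + 1)))) \<longlongrightarrow> 0) at_top"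
    using \<beta> by (intro tendsto_neg_powr filterlim_ident) auto
  from filterlim_compose[OF this n_over_log_powr_at_top] show ?thesis
    by (simp add: \<delta>[abs_def])
qed

lemma n_rate_sq_eq:
  "real n * (\<delta> n)\<^sup>2 = real n * (real n / ln (real n) powr w) powr (- (2 * \<beta> / (2 * \<beta> + 1)))"
proof -
  have "- (2 * \<beta> / (2 * \<beta> + 1)) = - (\<beta> / (2 * \<beta> + 1)) + - (\<beta> / (2 * \<beta> + 1))" by simp
  then show ?thesis unfolding \<delta> power2_eq_square by (simp only: powr_add)
qed

text \<open>For n \<ge> 3 the logarithm is at least 1. Dropping it inside the negative power can
  only decrease the value, and a positive power of \<open>n\<close> remains.\<close>

lemma n_rate_sq_at_top: "filterlim (\<lambda>n. real n * (\<delta> n)\<^sup>2) at_top sequentially"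
proof (rule filterlim_at_top_mono)
  show "filterlim (\<lambda>n. real n powr (1 / (2 * \<beta> + 1))) at_top sequentially"
    using \<beta> by real_asymp
  show "eventually (\<lambda>n. real n powr (1 / (2 * \<beta> + 1)) \<le> real n * (\<delta> n)\<^sup>2) sequentially"
    using eventually_ge_at_top[of 3]
  proof eventually_elim
    case (elim n)
    have "exp 1 \<le> real n" using elim exp_le by linarith
    then have ln1: "1 \<le> ln (real n)" using elim by (subst ln_ge_iff) auto
    then have lw: "1 \<le> ln (real n) powr w" using w by (intro ge_one_powr_ge_zero) auto
    have "real n powr (1 / (2 * \<beta> + 1)) = real n * real n powr (- (2 * \<beta> / (2 * \<beta> + 1)))"
    proof -
      have "1 / (2 * \<beta> + 1) = 1 + - (2 * \<beta> / (2 * \<beta> + 1))" using \<beta> by (simp add: field_simps)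
      then have "real n powr (1 / (2 * \<beta> + 1)) = real n powr 1 * real n powr (- (2 * \<beta> / (2 * \<beta> + 1)))"
        by (simp only: powr_add)
      then show ?thesis by simp
    qed
    also have "\<dots> \<le> real n * (real n / ln (real n) powr w) powr (- (2 * \<beta> / (2 * \<beta> + 1)))"
      using elim lw \<beta> by (intro mult_left_mono powr_mono2') (auto simp: field_simps mult_le_cancel_left1)
    finally show ?case by (simp add: n_rate_sq_eq)
  qed
qed

text \<open>The level balances approximation against prior cost. With R = n / (ln n) powr w, taking
  2^J near R powr (1 / (2 * \<beta> + 1)) makes the bias of order \<delta> and the cost of order n *
  \<delta>^2. The constant 2 powr \<beta> pays for rounding, and 2 powr w for bounding
  \<open>J\<close> by 2 * ln n.\<close>

lemma eventually_resolution_level: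
  "eventually (\<lambda>n. \<exists>J\<ge>1. 2 powr (- (real J * \<beta>)) \<le> 2 powr \<beta> * \<delta> n \<and>
     2 ^ J * real J powr w \<le> 2 powr w * (real n * (\<delta> n)\<^sup>2)) sequentially"
proof -
  \<comment> \<open>This threshold makes \<open>y\<close> at least 2, hence the rounded-down level
    at least 1.\<close>
  have "eventually (\<lambda>n. 2 powr (2 * \<beta> + 1) \<le> real n / ln (real n) powr w) sequentially"
    using n_over_log_powr_at_top by (simp add: filterlim_at_top)
  then show ?thesis
    using eventually_ge_at_top[of 3]
  proof eventually_elim
    case (elim n)
    define R where "R = real n / ln (real n) powr w"
    \<comment> \<open>The ideal value of 2^J: \<open>y powr (- \<beta>)\<close> is exactly \<delta>,
      and y * (ln n) powr w is exactly n * \<delta>^2.\<close>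
    define y where "y = R powr (1 / (2 * \<beta> + 1))"
    define J where "J = nat \<lfloor>log 2 y\<rfloor>"
    have "exp 1 \<le> real n" using elim exp_le by linarith
    then have ln1: "1 \<le> ln (real n)" using elim by (subst ln_ge_iff) auto
    then have lw: "1 \<le> ln (real n) powr w" using w by (intro ge_one_powr_ge_zero) auto
    have R2: "2 powr (2 * \<beta> + 1) \<le> R" using elim by (simp add: R_def)
    then have R: "0 < R" using powr_gt_zero[of 2 "2 * \<beta> + 1"] by linarith
    have y0: "0 < y" using R by (simp add: y_def)
    have "2 = (2 powr (2 * \<beta> + 1)) powr (1 / (2 * \<beta> + 1))" using \<beta> by (simp add: powr_powr)
    also have "\<dots> \<le> y" unfolding y_def using \<beta> R2 by (intro powr_mono2) auto
    finally have y2: "2 \<le> y" .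
    then have log1: "1 \<le> log 2 y" by (simp add: le_log_iff)
    then have J1: "1 \<le> J" unfolding J_def by linarith
    have J_le: "real J \<le> log 2 y" and J_gt: "log 2 y < real J + 1"
      using log1 unfolding J_def by linarith+
    have two_J: "2 ^ J \<le> y"
      using J_le y0 by (simp add: le_log_iff powr_realpow)
    have "y < 2 powr (real J + 1)" using J_gt y0 by (simp add: log_less_iff)
    then have "(2 powr (real J + 1)) powr (- \<beta>) \<le> y powr (- \<beta>)"
      using \<beta> y0 by (intro powr_mono2') auto
    also have "y powr (- \<beta>) = \<delta> n"
      using \<beta> by (simp add: y_def \<delta> R_def powr_powr)
    finally have "2 powr \<beta> * 2 powr (- ((real J + 1) * \<beta>)) \<le> 2 powr \<beta> * \<delta> n"
      by (intro mult_left_mono) (auto simp: powr_powr)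
    moreover have "2 powr \<beta> * 2 powr (- ((real J + 1) * \<beta>)) = 2 powr (- (real J * \<beta>))"
      by (simp add: algebra_simps flip: powr_add)
    ultimately have small: "2 powr (- (real J * \<beta>)) \<le> 2 powr \<beta> * \<delta> n" by simp
    have "R \<le> real n" using lw elim by (simp add: R_def field_simps mult_le_cancel_left1)
    have "y \<le> real n"
    proof -
      have "1 \<le> R" using R2 ge_one_powr_ge_zero[of 2 "2 * \<beta> + 1"] \<beta> by simp
      then have "y \<le> R powr 1" unfolding y_def using \<beta> by (intro powr_mono) auto
      then show ?thesis using \<open>R \<le> real n\<close> R by simp
    qed
    then have "real J \<le> log 2 (real n)" using J_le y0 by (smt (verit) log_le_cancel_iff)
    also have "\<dots> \<le> 2 * ln (real n)"
    proof -
      have "1 / 2 \<le> ln (2::real)" using ln2_ge_two_thirds by simp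
      then have "1 / ln 2 \<le> (2::real)" by (simp add: field_simps)
      then have "ln (real n) * (1 / ln 2) \<le> ln (real n) * 2" using ln1 by (intro mult_left_mono) auto
      then show ?thesis by (simp add: log_def)
    qed
    finally have "real J powr w \<le> (2 * ln (real n)) powr w" using w by (intro powr_mono2) auto
    then have "2 ^ J * real J powr w \<le> y * (2 powr w * ln (real n) powr w)"
      using two_J y0 by (intro mult_mono) (auto simp: powr_mult)
    also have "\<dots> = 2 powr w * (y * (real n / R))"
      using elim lw by (simp add: R_def)
    also have "y * (real n / R) = real n * R powr (1 / (2 * \<beta> + 1) - 1)"
      using R by (simp add: y_def powr_diff)
    also have "1 / (2 * \<beta> + 1) - 1 = - (2 * \<beta> / (2 * \<beta> + 1))" using \<beta> by (simp add: field_simps)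
    finally have "2 ^ J * real J powr w \<le> 2 powr w * (real n * (\<delta> n)\<^sup>2)"
      by (simp add: n_rate_sq_eq R_def)
    with small J1 show ?case by blast
  qed
qed

end

section \<open>From prior mass to contraction\<close>

text \<open>The posterior is pulled back along the map defining the prior, so both of its integrals
  run over the coefficient space. The closeness is u / 2 because normalisation doubles it.\<close>

lemma rho_posterior_expectation_le:
  fixes \<psi> :: "nat \<Rightarrow> nat \<Rightarrow> real \<Rightarrow> real" and \<zeta> :: "nat \<Rightarrow> nat \<Rightarrow> 'w \<Rightarrow> real"
  assumes P: "prob_space P" and basis: "wavelet_basis \<psi>"
    and \<zeta>: "\<And>l k. k \<in> K l \<Longrightarrow> \<zeta> l k \<in> borel_measurable P"
    and g0: "density_on_unit g0" "\<And>x. 0 \<le> x \<Longrightarrow> x \<le> 1 \<Longrightarrow> 0 < g0 x"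
    and f0: "AE x in unit_measure. wavelet_series \<psi> a x = ln (g0 x)"
    and \<rho>: "0 < \<rho>" "\<rho> < 1" and r: "0 < r" and b: "0 < b"
    and A: "A \<in> sets P" and A0: "0 < measure P A" and u: "0 \<le> u" "u \<le> 1"
    and near: "\<And>\<omega> x. \<omega> \<in> A \<Longrightarrow> x \<in> {0..1} \<Longrightarrow>
      \<bar>wavelet_series \<psi> (\<lambda>l k. s l * \<zeta> l k \<omega>) x - wavelet_series \<psi> a x\<bar> \<le> u / 2"
  shows "(\<integral>\<^sup>+X. rho_posterior \<rho> (density_prior P \<psi> s \<zeta>) n X {g. L1_norm (\<lambda>x. g x - g0 x) > ennreal r}
      \<partial>sample_law g0 n)
    \<le> ennreal (b * exp (- (real n * (min \<rho> (1 - \<rho>) * r\<^sup>2 / 4)))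
        + exp (real n * (2 * u\<^sup>2)) / (b * measure P A))"
proof -
  note \<psi> = wavelet_basis_measurable[OF basis]
  define F where "F \<omega> = wavelet_series \<psi> (\<lambda>l k. s l * \<zeta> l k \<omega>)" for \<omega>
  define G where "G \<omega> = exp_density (F \<omega>)" for \<omega>
  let ?B = "{g. L1_norm (\<lambda>x. g x - g0 x) > ennreal r}"
  have F_meas: "F \<omega> \<in> borel_measurable unit_measure" for \<omega>
    unfolding F_def by (rule wavelet_series_measurable[OF basis])
  have G: "G \<in> P \<rightarrow>\<^sub>M function_space"
    unfolding G_def F_def by (intro measurable_exp_density_function_space \<psi> \<zeta>)
  have pair: "(\<lambda>(\<omega>, x). G \<omega> x) \<in> borel_measurable (P \<Otimes>\<^sub>M unit_measure)"
    unfolding G_def F_def by (rule measurable_exp_density_pair[OF \<psi> \<zeta>])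
  have B: "?B \<in> sets function_space"
    using g0 by (intro sets_L1_dist_greater) (simp add: density_on_unit_def)
  let ?BP = "G -` ?B \<inter> space P"
  have eq: "rho_posterior \<rho> (density_prior P \<psi> s \<zeta>) n X ?B =
      (\<integral>\<^sup>+\<omega>. ennreal ((\<Prod>i<n. G \<omega> (X i)) powr \<rho>) * indicator ?BP \<omega> \<partial>P) /
      (\<integral>\<^sup>+\<omega>. ennreal ((\<Prod>i<n. G \<omega> (X i)) powr \<rho>) \<partial>P)" if X: "X \<in> space (sample_law g0 n)" for X
  proof -
    have "(\<lambda>g. g (X i)) \<in> borel_measurable function_space" if "i < n" for i
      using space_sample_lawD[OF X that] by (rule measurable_eval_function_space)
    then have lik: "(\<lambda>g. ennreal ((\<Prod>i<n. g (X i)) powr \<rho>)) \<in> borel_measurable function_space"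
      by measurable
    have prior: "density_prior P \<psi> s \<zeta> = distr P function_space G"
      unfolding density_prior_def G_def[abs_def] F_def ..
    have num: "(\<integral>\<^sup>+g\<in>?B. ennreal ((\<Prod>i<n. g (X i)) powr \<rho>) \<partial>distr P function_space G)
        = (\<integral>\<^sup>+\<omega>. ennreal ((\<Prod>i<n. G \<omega> (X i)) powr \<rho>) * indicator ?BP \<omega> \<partial>P)"
      using lik B by (subst nn_integral_distr[OF G])
        (auto intro!: nn_integral_cong split: split_indicator)
    have den: "(\<integral>\<^sup>+g. ennreal ((\<Prod>i<n. g (X i)) powr \<rho>) \<partial>distr P function_space G)
        = (\<integral>\<^sup>+\<omega>. ennreal ((\<Prod>i<n. G \<omega> (X i)) powr \<rho>) \<partial>P)"
      using lik by (subst nn_integral_distr[OF G]) auto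
    show ?thesis unfolding rho_posterior_def prior num den ..
  qed
  have ae: "AE x in unit_measure. \<bar>F \<omega> x - ln (g0 x)\<bar> \<le> u / 2" if "\<omega> \<in> A" for \<omega>
    using f0 AE_space[of unit_measure]
  proof eventually_elim
    case (elim x)
    then show ?case using near[OF that, of x] by (simp add: F_def space_restrict_space)
  qed
  have near': "density_on_unit (G \<omega>)" "0 < G \<omega> x"
    "AE x in unit_measure. \<bar>ln (G \<omega> x) - ln (g0 x)\<bar> \<le> 2 * (u / 2)" if "\<omega> \<in> A" for \<omega> x
    unfolding G_def by (rule exp_density_near[OF g0(1) _ F_meas ae[OF that]]; rule g0(2); assumption)+
  have "(\<integral>\<^sup>+X. rho_posterior \<rho> (density_prior P \<psi> s \<zeta>) n X ?B \<partial>sample_law g0 n)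
      = (\<integral>\<^sup>+X. (\<integral>\<^sup>+\<omega>. ennreal ((\<Prod>i<n. G \<omega> (X i)) powr \<rho>) * indicator ?BP \<omega> \<partial>P) /
      (\<integral>\<^sup>+\<omega>. ennreal ((\<Prod>i<n. G \<omega> (X i)) powr \<rho>) \<partial>P) \<partial>sample_law g0 n)"
    by (intro nn_integral_cong eq)
  also have "\<dots> \<le> ennreal (b * exp (- (real n * (min \<rho> (1 - \<rho>) * r\<^sup>2 / 4)))
        + exp (real n * (2 * u\<^sup>2)) / (b * measure P A))"
  proof (rule nn_integral_tempered_posterior_le[OF P pair g0 \<rho> r b _ _ _ A A0 u])
    show "density_on_unit (G \<omega>) \<or> (\<forall>x. G \<omega> x = 0)" for \<omega>
      unfolding G_def by (rule exp_density_cases[OF F_meas])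
    show "?BP \<in> sets P" by (rule measurable_sets[OF G B])
    show "AE x in unit_measure. \<bar>ln (G \<omega> x) - ln (g0 x)\<bar> \<le> u" if "\<omega> \<in> A" for \<omega>
      using near'(3)[OF that] by simp
  qed (use near'(1,2) in auto)
  finally show ?thesis .
qed

text \<open>Everything is measured in m = n * \<delta>^2: the prior mass costs
  \<open>c' * m\<close>, the inverse affinity 2 * U^2 * m. A weight exceeding both and a still
  larger separation constant bound each half by exp (- m). Since \<epsilon> eventually dominates
  \<delta>, closeness is taken at scale \<delta> and separation at scale \<epsilon>.\<close>

lemma tempered_posterior_contraction:
  fixes \<psi> :: "nat \<Rightarrow> nat \<Rightarrow> real \<Rightarrow> real" and \<zeta> :: "nat \<Rightarrow> nat \<Rightarrow> 'w \<Rightarrow> real" and p :: nat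
  assumes basis: "wavelet_basis \<psi>"
    and g0: "density_on_unit g0" and pos0: "\<And>x. 0 \<le> x \<Longrightarrow> x \<le> 1 \<Longrightarrow> 0 < g0 x"
    and f0: "(\<lambda>x. ln (g0 x)) \<in> holder_ball \<psi> \<beta> L"
    and h: "density_on_real h" and sym: "\<And>x. h (- x) = h x" and pos: "\<And>x. 0 < h x"
    and anti: "antimono_on {0..} h"
    and c1: "0 < c1" and \<kappa>: "0 \<le> \<kappa>"
    and h_log: "\<And>x. x \<ge> 0 \<Longrightarrow> ln (1 / h x) \<le> c1 * (1 + ln (1 + x) powr (1 + \<kappa>))"
    and c2: "0 < c2" and tail: "\<And>x. x \<ge> 1 \<Longrightarrow> (LINT u:{x..}|lborel. h u) \<le> c2 / x\<^sup>2"
    and P: "prob_space P"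
    and law: "\<And>l k. k \<in> K l \<Longrightarrow> distributed P lborel (\<zeta> l k) (\<lambda>x. ennreal (h x))"
    and indep: "prob_space.indep_vars P (\<lambda>_. borel) (\<lambda>(l, k). \<zeta> l k) (SIGMA l:UNIV. K l)"
    and \<beta>: "0 < \<beta>" and L: "0 < L" and \<alpha>: "1/2 < \<alpha>" "\<beta> \<le> \<alpha>" and S: "0 < S"
    and s: "\<And>l. 0 < s l" "\<And>l. s l \<le> 1" "\<And>l. s l \<le> S * 2 powr (- (real l * (1/2 + \<alpha>)))"
    and q: "0 \<le> q" and p: "1 \<le> p"
    and s_lower: "\<And>l J. l \<le> J \<Longrightarrow> 1 / s l \<le> 2 powr (q * real J ^ p)"
    and \<delta>: "\<And>n. \<delta> n = (real n / ln (real n) powr (real p * (1 + \<kappa>))) powr (- (\<beta> / (2 * \<beta> + 1)))"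
    and \<epsilon>: "eventually (\<lambda>n. \<delta> n \<le> \<epsilon> n) sequentially"
    and \<rho>: "0 < \<rho>" "\<rho> < 1"
  shows "\<exists>M>0. (\<lambda>n. \<integral>\<^sup>+ X. rho_posterior \<rho> (density_prior P \<psi> s \<zeta>) n X
        {g. L1_norm (\<lambda>x. g x - g0 x) > ennreal (M * \<epsilon> n)} \<partial>sample_law g0 n) \<longlonglongrightarrow> 0"
proof -
  define w where "w = real p * (1 + \<kappa>)"
  have w: "0 < w" using p \<kappa> by (simp add: w_def)
  note \<delta>w = \<delta>[folded w_def]
  define a where "a l k = inner_L2 (\<lambda>x. ln (g0 x)) (\<psi> l k)" for l k
  have sq0: "square_integrable (\<lambda>x. ln (g0 x))" using f0 by (simp add: holder_ball_def)
  have a: "\<bar>a l k\<bar> \<le> 2 powr (- (real l * (1/2 + \<beta>))) * L" if "k \<in> K l" for l k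
  proof -
    have "\<bar>a l k\<bar> \<le> (MAX k\<in>K l. \<bar>a l k\<bar>)" using that by (intro Max_ge) (auto simp: K_def)
    then show ?thesis using f0 by (auto simp: holder_ball_def a_def intro: order_trans)
  qed
  have \<zeta>: "\<zeta> l k \<in> borel_measurable P" if "k \<in> K l" for l k
    using distributed_measurable[OF law[OF that]] by simp
  obtain C where C: "\<And>l x. x \<in> {0..1} \<Longrightarrow> (\<Sum>k\<in>K l. \<bar>\<psi> l k x\<bar>) \<le> C * 2 powr (real l / 2)"
    using basis unfolding wavelet_basis_def by blast
  have f0_eq: "AE x in unit_measure. wavelet_series \<psi> a x = ln (g0 x)"
    unfolding a_def
  proof (rule wavelet_series_inner_L2_AE_eq[OF basis sq0])
    show "summable (\<lambda>l. C * L * (2 powr (- \<beta>)) ^ l)"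
      using \<beta> by (intro summable_mult summable_geometric) (auto simp: powr_less_one)
    show "\<bar>\<Sum>k\<in>K l. inner_L2 (\<lambda>x. ln (g0 x)) (\<psi> l k) * \<psi> l k x\<bar> \<le> C * L * (2 powr (- \<beta>)) ^ l"
      if "0 \<le> x" "x \<le> 1" for l x
      using that by (intro wavelet_level_sum_holder_le C a[unfolded a_def]) auto
  qed
  let ?ball = "\<lambda>c D J A. exp (- (c * (2 ^ J * real J powr w))) \<le> measure P A \<and>
       (\<forall>\<omega>\<in>A. \<forall>x\<in>{0..1}. \<bar>wavelet_series \<psi> (\<lambda>l k. s l * \<zeta> l k \<omega>) x - wavelet_series \<psi> a x\<bar>
          \<le> D * 2 powr (- (real J * \<beta>)))"
  have "\<exists>c D. 0 < c \<and> 0 \<le> D \<and> (\<forall>J\<ge>1. \<exists>A\<in>sets P. ?ball c D J A)"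
    unfolding w_def
    by (rule prior_small_ball[where h = h and ?c1.0 = c1 and ?c2.0 = c2 and L = L and \<alpha> = \<alpha> and S = S and q = q]) fact+
  then obtain c D where c: "0 < c" and D: "0 \<le> D" and ball: "\<forall>J\<ge>1. \<exists>A\<in>sets P. ?ball c D J A"
    by (elim exE conjE) (rule that)
  \<comment> \<open>The factor 2 anticipates the doubling by normalisation, and 2 powr \<beta> the
    rounding of the level.\<close>
  define U where "U = 2 * D * 2 powr \<beta>"
  define c' where "c' = c * 2 powr w"
  \<comment> \<open>The exponent rate of the weight: prior cost plus inverse affinity, plus 1 so
    that exp (- m) is left over.\<close>
  define E where "E = c' + 2 * U\<^sup>2 + 1"
  define \<gamma> where "\<gamma> = min \<rho> (1 - \<rho>)"
  \<comment> \<open>Solves \<open>\<gamma> * M\<^sup>2 / 4 = E + 1\<close>, so the far part beats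
    the weight by exp (- m).\<close>
  define M where "M = sqrt (4 * (E + 1) / \<gamma>)"
  define m where "m n = real n * (\<delta> n)\<^sup>2" for n
  have \<gamma>: "0 < \<gamma>" using \<rho> by (simp add: \<gamma>_def)
  have E: "0 < E" using c by (auto simp: E_def c'_def intro!: add_pos_pos add_pos_nonneg)
  have M: "0 < M" "\<gamma> * M\<^sup>2 / 4 = E + 1" using \<gamma> E by (auto simp: M_def)
  have U: "0 \<le> U" using D by (simp add: U_def)
  have \<delta>0: "\<delta> \<longlonglongrightarrow> 0" by (rule rate_tendsto_0[OF \<beta> w \<delta>w])
  have m: "filterlim m at_top sequentially"
    unfolding m_def by (rule n_rate_sq_at_top[OF \<beta> w \<delta>w])
  let ?T = "\<lambda>n. \<integral>\<^sup>+ X. rho_posterior \<rho> (density_prior P \<psi> s \<zeta>) n X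
        {g. L1_norm (\<lambda>x. g x - g0 x) > ennreal (M * \<epsilon> n)} \<partial>sample_law g0 n"
  have "(\<lambda>n. U * \<delta> n) \<longlonglongrightarrow> U * 0" by (intro tendsto_intros \<delta>0)
  then have U1: "eventually (\<lambda>n. U * \<delta> n < 1) sequentially" by (rule order_tendstoD) simp
  have m1: "eventually (\<lambda>n. 1 \<le> m n) sequentially"
    using m by (simp add: filterlim_at_top)
  have le: "eventually (\<lambda>n. ?T n \<le> ennreal (2 * exp (- m n))) sequentially"
    using \<epsilon> U1 m1 eventually_resolution_level[OF \<beta> w \<delta>w]
  proof eventually_elim
    case (elim n)
    \<comment> \<open>The power of a zero base is 0, so strict positivity of \<delta> is read off
      from m \<ge> 1.\<close>
    have \<delta>n: "0 < \<delta> n"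
    proof -
      have "\<delta> n \<noteq> 0" using elim(3) by (auto simp: m_def)
      moreover have "0 \<le> \<delta> n" by (simp add: \<delta>)
      ultimately show ?thesis by simp
    qed
    obtain J where J: "1 \<le> J" "2 powr (- (real J * \<beta>)) \<le> 2 powr \<beta> * \<delta> n"
      "2 ^ J * real J powr w \<le> 2 powr w * m n"
      using elim(4) unfolding m_def by blast
    from ball[rule_format, OF J(1)]
    obtain A where A: "A \<in> sets P" "exp (- (c * (2 ^ J * real J powr w))) \<le> measure P A"
      and near: "\<forall>\<omega>\<in>A. \<forall>x\<in>{0..1}. \<bar>wavelet_series \<psi> (\<lambda>l k. s l * \<zeta> l k \<omega>) x - wavelet_series \<psi> a x\<bar>
          \<le> D * 2 powr (- (real J * \<beta>))"
      by (elim bexE conjE) (rule that)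
    have "c * (2 ^ J * real J powr w) \<le> c * (2 powr w * m n)"
      using c J(3) by (intro mult_left_mono) auto
    then have "exp (- (c' * m n)) \<le> exp (- (c * (2 ^ J * real J powr w)))"
      by (simp add: c'_def)
    then have PA: "exp (- (c' * m n)) \<le> measure P A" using A(2) by linarith
    have PA0: "0 < measure P A" using PA exp_gt_zero[of "- (c' * m n)"] by linarith
    have D_le: "D * 2 powr (- (real J * \<beta>)) \<le> U * \<delta> n / 2"
      using mult_left_mono[OF J(2) D] by (simp add: U_def ac_simps)
    have r: "0 < M * \<epsilon> n" using M(1) elim(1) \<delta>n by simp
    \<comment> \<open>The free weight is taken as exp (E * m): it multiplies the far part and
      divides the evidence part.\<close>
    have "?T n \<le> ennreal (exp (E * m n) * exp (- (real n * (min \<rho> (1 - \<rho>) * (M * \<epsilon> n)\<^sup>2 / 4)))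
        + exp (real n * (2 * (U * \<delta> n)\<^sup>2)) / (exp (E * m n) * measure P A))"
    proof (rule rho_posterior_expectation_le[OF P basis \<zeta> g0 pos0 f0_eq \<rho> r _ A(1) PA0])
      show "\<bar>wavelet_series \<psi> (\<lambda>l k. s l * \<zeta> l k \<omega>) x - wavelet_series \<psi> a x\<bar> \<le> U * \<delta> n / 2"
        if "\<omega> \<in> A" "x \<in> {0..1}" for \<omega> x
        using near[rule_format, OF that] D_le by linarith
    qed (use U \<delta>n elim(2) in auto)
    also have "\<dots> \<le> ennreal (exp (- m n) + exp (- m n))"
    proof (intro ennreal_leI add_mono)
      have "(\<delta> n)\<^sup>2 \<le> (\<epsilon> n)\<^sup>2" using elim(1) \<delta>n by (intro power_mono) auto
      then have "real n * (\<gamma> * M\<^sup>2 / 4 * (\<delta> n)\<^sup>2) \<le> real n * (\<gamma> * M\<^sup>2 / 4 * (\<epsilon> n)\<^sup>2)"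
        using \<gamma> by (intro mult_left_mono) auto
      moreover have "(E + 1) * m n = real n * (\<gamma> * M\<^sup>2 / 4 * (\<delta> n)\<^sup>2)"
        unfolding M(2) m_def by (simp only: ac_simps)
      moreover have "real n * (\<gamma> * M\<^sup>2 / 4 * (\<epsilon> n)\<^sup>2) = real n * (\<gamma> * (M * \<epsilon> n)\<^sup>2 / 4)"
        by (simp add: power_mult_distrib)
      moreover have "(E + 1) * m n = E * m n + m n" by (simp add: distrib_right)
      ultimately have "E * m n + - (real n * (\<gamma> * (M * \<epsilon> n)\<^sup>2 / 4)) \<le> - m n"
        by linarith
      then show "exp (E * m n) * exp (- (real n * (min \<rho> (1 - \<rho>) * (M * \<epsilon> n)\<^sup>2 / 4))) \<le> exp (- m n)"
        unfolding \<gamma>_def[symmetric] exp_add[symmetric] by (simp only: exp_le_cancel_iff)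
      have "exp (real n * (2 * (U * \<delta> n)\<^sup>2)) / (exp (E * m n) * measure P A)
          \<le> exp (real n * (2 * (U * \<delta> n)\<^sup>2)) / (exp (E * m n) * exp (- (c' * m n)))"
        using PA PA0 by (intro divide_left_mono mult_left_mono mult_pos_pos) auto
      also have "\<dots> = exp (real n * (2 * (U * \<delta> n)\<^sup>2) - (E * m n + - (c' * m n)))"
        by (simp only: exp_diff exp_add)
      also have "real n * (2 * (U * \<delta> n)\<^sup>2) - (E * m n + - (c' * m n)) = - m n"
      proof -
        have "real n * (2 * (U * \<delta> n)\<^sup>2) = 2 * U\<^sup>2 * m n"
          by (simp add: m_def power_mult_distrib)
        then show ?thesis by (simp add: E_def distrib_right)
      qed
      finally show "exp (real n * (2 * (U * \<delta> n)\<^sup>2)) / (exp (E * m n) * measure P A) \<le> exp (- m n)" .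
    qed
    finally show ?case by (simp only: mult_2)
  qed
  have "filterlim (\<lambda>n. - m n) at_bot sequentially"
    using m by (simp add: filterlim_uminus_at_top)
  then have "(\<lambda>n. exp (- m n)) \<longlonglongrightarrow> 0" by (rule filterlim_compose[OF exp_at_bot])
  then have "(\<lambda>n. ennreal (2 * exp (- m n))) \<longlonglongrightarrow> ennreal (2 * 0)"
    by (intro tendsto_ennrealI tendsto_mult tendsto_const)
  then have lim: "(\<lambda>n. ennreal (2 * exp (- m n))) \<longlonglongrightarrow> 0" by simp
  have "?T \<longlonglongrightarrow> 0"
    by (rule tendsto_sandwich[OF always_eventually le tendsto_const lim]) (rule allI, rule zero_le)
  with M(1) show ?thesis by (intro exI[of _ M] conjI)
qed

theorem theorem8:
  fixes \<psi> :: "nat \<Rightarrow> nat \<Rightarrow> real \<Rightarrow> real"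
    and g0 h :: "real \<Rightarrow> real"
    and \<alpha> \<beta> L \<kappa> c1 c2 :: real
    and P :: "'w measure"
    and \<zeta> :: "nat \<Rightarrow> nat \<Rightarrow> 'w \<Rightarrow> real"
    and s \<epsilon> :: "nat \<Rightarrow> real"
  assumes basis: "wavelet_basis \<psi>"
    and g0_density: "density_on_unit g0"
    and g0_bounded_away: "\<exists>c>0. \<forall>x\<in>{0..1}. c \<le> g0 x"
    and \<beta>: "\<beta> > 0" and L: "L > 0"
    and f0: "(\<lambda>x. ln (g0 x)) \<in> holder_ball \<psi> \<beta> L"
    and h_density: "density_on_real h"
    and h_symmetric: "\<And>x. h (- x) = h x"
    and h_positive: "\<And>x. h x > 0"
    and h_bounded: "bounded (range h)"
    and h_decreasing: "antimono_on {0..} h"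
    and c1: "c1 > 0" and \<kappa>: "\<kappa> \<ge> 0"
    and h_log: "\<And>x. x \<ge> 0 \<Longrightarrow> ln (1 / h x) \<le> c1 * (1 + ln (1 + x) powr (1 + \<kappa>))"
    and c2: "c2 > 0"
    and h_tail: "\<And>x. x \<ge> 1 \<Longrightarrow> (LINT u:{x..}|lborel. h u) \<le> c2 / x\<^sup>2"
    and P: "prob_space P"
    and \<zeta>_law: "\<And>l k. k \<in> K l \<Longrightarrow> distributed P lborel (\<zeta> l k) (\<lambda>x. ennreal (h x))"
    and \<zeta>_indep: "prob_space.indep_vars P (\<lambda>_. borel) (\<lambda>(l, k). \<zeta> l k) (SIGMA l:UNIV. K l)"
    and setting:
      "(\<alpha> > 1/2 \<and> \<beta> \<le> \<alpha> \<and>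
        (\<forall>l. s l = 2 powr (- (real l * (1/2 + \<alpha>)))) \<and>
        (\<forall>n. \<epsilon> n = ln (ln (real n)) powr (2 / (1 + 2*\<beta>))
                 * ln (real n) powr ((1 + (1 + \<kappa>) * \<beta>) / (1 + 2*\<beta>))
                 * real n powr (- (\<beta> / (2*\<beta> + 1)))))
       \<or>
       ((\<forall>l. s l = 2 powr (- (real l ^ 2))) \<and>
        (\<forall>n. \<epsilon> n = ln (real n) powr ((2 + 2*\<kappa>) * \<beta> / (1 + 2*\<beta>))
                 * real n powr (- (\<beta> / (2*\<beta> + 1)))))"
  shows "\<forall>\<rho>\<in>{0<..<1}. \<exists>M>0.
    (\<lambda>n. \<integral>\<^sup>+ X. rho_posterior \<rho> (density_prior P \<psi> s \<zeta>) n X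
                 {g. L1_norm (\<lambda>x. g x - g0 x) > ennreal (M * \<epsilon> n)} \<partial>sample_law g0 n)
      \<longlonglongrightarrow> 0"
proof
  fix \<rho> :: real assume "\<rho> \<in> {0<..<1}"
  then have \<rho>: "0 < \<rho>" "\<rho> < 1" by auto
  have g0_pos: "0 < g0 x" if "0 \<le> x" "x \<le> 1" for x
    using g0_bounded_away that by force
  let ?concl = "\<exists>M>0. (\<lambda>n. \<integral>\<^sup>+ X. rho_posterior \<rho> (density_prior P \<psi> s \<zeta>) n X
      {g. L1_norm (\<lambda>x. g x - g0 x) > ennreal (M * \<epsilon> n)} \<partial>sample_law g0 n) \<longlonglongrightarrow> 0"
  have ln1: "1 \<le> ln (real n)" if "3 \<le> n" for n
    using that exp_le by (subst ln_ge_iff) auto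
  have rate: "(real n / ln (real n) powr w) powr (- (\<beta> / (2 * \<beta> + 1)))
      = ln (real n) powr (w * \<beta> / (1 + 2 * \<beta>)) * real n powr (- (\<beta> / (2 * \<beta> + 1)))" if "3 \<le> n" for n w
  proof -
    have "(real n / ln (real n) powr w) powr (- (\<beta> / (2 * \<beta> + 1)))
        = real n powr (- (\<beta> / (2 * \<beta> + 1))) / ln (real n) powr (- (w * \<beta> / (1 + 2 * \<beta>)))"
      by (simp add: powr_divide powr_powr add.commute)
    also have "\<dots> = ln (real n) powr (w * \<beta> / (1 + 2 * \<beta>)) * real n powr (- (\<beta> / (2 * \<beta> + 1)))"
      unfolding powr_minus[of "ln (real n)"] by (simp add: divide_inverse)
    finally show ?thesis .
  qed
  from setting show ?concl
  proof (elim disjE conjE)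
    assume \<alpha>: "1/2 < \<alpha>" "\<beta> \<le> \<alpha>" and s: "\<forall>l. s l = 2 powr (- (real l * (1/2 + \<alpha>)))"
      and \<epsilon>: "\<forall>n. \<epsilon> n = ln (ln (real n)) powr (2 / (1 + 2*\<beta>))
        * ln (real n) powr ((1 + (1 + \<kappa>) * \<beta>) / (1 + 2*\<beta>)) * real n powr (- (\<beta> / (2*\<beta> + 1)))"
    have lnln: "eventually (\<lambda>n. 1 \<le> ln (ln (real n))) sequentially" by real_asymp
    \<comment> \<open>The rate delivered by p = 1 lacks the iterated logarithm and has a smaller
      power of ln n. Both discrepancies are factors at least 1 once ln (ln n) \<ge> 1, so \<epsilon>
      dominates it.\<close>
    have rate_le: "eventually (\<lambda>n. (real n / ln (real n) powr (real 1 * (1 + \<kappa>))) powr (- (\<beta> / (2 * \<beta> + 1)))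
        \<le> \<epsilon> n) sequentially"
      using lnln eventually_ge_at_top[of 3]
    proof eventually_elim
      case (elim n)
      have "1 \<le> ln (ln (real n)) powr (2 / (1 + 2 * \<beta>))"
        using elim \<beta> by (intro ge_one_powr_ge_zero) auto
      moreover have "ln (real n) powr ((1 + \<kappa>) * \<beta> / (1 + 2 * \<beta>))
          \<le> ln (real n) powr ((1 + (1 + \<kappa>) * \<beta>) / (1 + 2 * \<beta>))"
      proof (rule powr_mono)
        show "(1 + \<kappa>) * \<beta> / (1 + 2 * \<beta>) \<le> (1 + (1 + \<kappa>) * \<beta>) / (1 + 2 * \<beta>)"
          using \<beta> by (intro divide_right_mono) auto
      qed (rule ln1[OF elim(2)])
      ultimately have "1 * ln (real n) powr ((1 + \<kappa>) * \<beta> / (1 + 2 * \<beta>))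
          \<le> ln (ln (real n)) powr (2 / (1 + 2 * \<beta>)) * ln (real n) powr ((1 + (1 + \<kappa>) * \<beta>) / (1 + 2 * \<beta>))"
        by (intro mult_mono) auto
      then show ?case using elim by (simp add: rate \<epsilon> mult_right_mono)
    qed
    have q: "0 \<le> 1/2 + \<alpha>" using \<alpha> by simp
    have s_lower: "1 / s l \<le> 2 powr ((1/2 + \<alpha>) * real J ^ 1)" if "l \<le> J" for l J
    proof -
      have "1 / s l = 2 powr (real l * (1/2 + \<alpha>))" unfolding s[rule_format] by (simp only: powr_minus divide_inverse inverse_inverse_eq mult_1_left)
      also have "\<dots> \<le> 2 powr (real J * (1/2 + \<alpha>))"
        using that q by (intro powr_mono mult_right_mono) auto
      finally show ?thesis by (simp add: mult.commute)
    qed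
    have s_le1: "s l \<le> 1" for l
    proof -
      have "2 powr (- (real l * (1/2 + \<alpha>))) \<le> (2::real) powr 0"
        using q by (intro powr_mono) auto
      then show ?thesis unfolding s[rule_format] by simp
    qed
    have s_upper: "s l \<le> 1 * 2 powr (- (real l * (1/2 + \<alpha>)))" for l unfolding s[rule_format] by simp
    have s_pos: "0 < s l" for l unfolding s[rule_format] by simp
    show ?concl
      by (rule tempered_posterior_contraction[where p = 1 and q = "1/2 + \<alpha>" and S = 1 and \<alpha> = \<alpha>
        and h = h and L = L and ?c1.0 = c1 and ?c2.0 = c2 and \<kappa> = \<kappa> and \<beta> = \<beta>
        and \<delta> = "\<lambda>n. (real n / ln (real n) powr (real 1 * (1 + \<kappa>))) powr (- (\<beta> / (2 * \<beta> + 1)))"])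
        (rule refl zero_less_one le_refl | fact)+
  next
    assume s: "\<forall>l. s l = 2 powr (- (real l ^ 2))"
      and \<epsilon>: "\<forall>n. \<epsilon> n = ln (real n) powr ((2 + 2*\<kappa>) * \<beta> / (1 + 2*\<beta>)) * real n powr (- (\<beta> / (2*\<beta> + 1)))"
    \<comment> \<open>The general bound is applied with smoothness exponent \<beta> + 1, which
      exceeds 1/2 and \<beta>; \<open>t\<close> is the resulting decay exponent per level.\<close>
    define t where "t = 1/2 + (\<beta> + 1)"
    have t: "1/2 < \<beta> + 1" "\<beta> \<le> \<beta> + 1" using \<beta> by auto
    \<comment> \<open>With p = 2 the logarithmic exponent is 2 * (1 + \<kappa>), and the rate
      coincides with \<epsilon> for n \<ge> 3.\<close>
    have rate_le: "eventually (\<lambda>n. (real n / ln (real n) powr (real 2 * (1 + \<kappa>))) powr (- (\<beta> / (2 * \<beta> + 1)))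
        \<le> \<epsilon> n) sequentially"
      using eventually_ge_at_top[of 3] by eventually_elim (simp add: rate \<epsilon> distrib_left)
    have s_lower: "1 / s l \<le> 2 powr (1 * real J ^ 2)" if "l \<le> J" for l J
    proof -
      have "1 / s l = 2 powr (real l ^ 2)" unfolding s[rule_format] by (simp only: powr_minus divide_inverse inverse_inverse_eq mult_1_left)
      also have "\<dots> \<le> 2 powr (1 * real J ^ 2)"
        using that by (intro powr_mono) (auto intro: power_mono)
      finally show ?thesis .
    qed
    \<comment> \<open>Quadratic decay in the exponent beats any linear one up to a constant, by l *
      t \<le> l^2 + t^2; this fixes the constant 2 powr (t^2).\<close>
    have s_upper: "s l \<le> 2 powr (t\<^sup>2) * 2 powr (- (real l * (1/2 + (\<beta> + 1))))" for l
    proof -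
      have "real l * t \<le> (real l)\<^sup>2 + t\<^sup>2"
      proof -
        have "2 * (real l * t) \<le> (real l)\<^sup>2 + t\<^sup>2"
          using zero_le_power2[of "real l - t"] by (simp add: power2_diff)
        moreover have "0 \<le> (real l)\<^sup>2 + t\<^sup>2" by simp
        ultimately show ?thesis by linarith
      qed
      then have "2 powr (- (real l ^ 2)) \<le> 2 powr (t\<^sup>2 + - (real l * t))"
        by (intro powr_mono) auto
      then show ?thesis unfolding s[rule_format] by (simp only: powr_add t_def)
    qed
    have s_le1: "s l \<le> 1" for l
      unfolding s[rule_format] using powr_mono[of "- (real l ^ 2)" 0 2] by simp
    have s_pos: "0 < s l" for l unfolding s[rule_format] by simp
    have S: "0 < (2::real) powr (t\<^sup>2)" by simp
    have p: "1 \<le> (2::nat)" by simp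
    show ?concl
      by (rule tempered_posterior_contraction[where p = 2 and q = 1 and S = "2 powr (t\<^sup>2)" and \<alpha> = "\<beta> + 1"
        and h = h and L = L and ?c1.0 = c1 and ?c2.0 = c2 and \<kappa> = \<kappa> and \<beta> = \<beta>
        and \<delta> = "\<lambda>n. (real n / ln (real n) powr (real 2 * (1 + \<kappa>))) powr (- (\<beta> / (2 * \<beta> + 1)))"])
        (rule refl zero_le_one | fact)+
  qed
qed

end
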